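(* Let $(\mathcal V,\times,1_{\mathcal V})$ be a complete and cocomplete Cartesian closed category, regarded as a symmetric monoidal category via its Cartesian product, and let $(\mathcal C,\otimes,1_{\mathcal C})$ be a symmetric monoidal $\mathcal V$-category. Then for any (symmetric) operad $\mathcal P$ in $\mathcal V$ (not necessarily unital), the $\mathcal V$-enriched $\mathcal P$-coalgebras in $\mathcal C$, with mapping objects $\underline{\mathcal P\text{-}\mathsf{Coalg}}(X,Y)$ as defined in the context and with composition and identities restricted from $\mathcal C$, form a $\mathcal V$-category.
   Context: For a $\mathcal V$-category $\mathcal C$ write $\underline{\mathcal C}(X,Y)\in\mathcal V$ for the hom-objects, $c$ for composition, $j_X:1_{\mathcal V}\to\underline{\mathcal C}(X,X)$ for identities. A symmetric monoidal $\mathcal V$-category is a symmetric pseudomonoid in the symmetric monoidal 2-category of $\mathcal V$-categories; in particular $\otimes$ is a $\mathcal V$-bifunctor, giving maps $T:\underline{\mathcal C}(A_1,B_1)\times\cdots\times\underline{\mathcal C}(A_r,B_r)\to\underline{\mathcal C}(A_1\otimes\cdots\otimes A_r,B_1\otimes\cdots\otimes B_r)$ in $\mathcal V$. An operad $\mathcal P$ in $\mathcal V$ consists of objects $\mathcal P(n)$, $n\ge 0$, with right $\mathbb S_n$-actions, a unit $1_{\mathcal V}\to\mathcal P(1)$ and compositions $\gamma:\mathcal P(k)\times\mathcal P(n_1)\times\cdots\times\mathcal P(n_k)\to\mathcal P(n_1+\cdots+n_k)$ satisfying the usual associativity, unitality and equivariance axioms. It is unital if $\mathcal P(0)=1_{\mathcal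 V}$. Coendomorphism operad: for $X\in\mathcal C$, $\mathsf{CoEnd}(X)(r)=\underline{\mathcal C}(X,X^{\otimes r})$, with $X^{\otimes 0}=1_{\mathcal C}$; the unit is $j_X$; the composition is $\underline{\mathcal C}(X,X^{\otimes r})\times\prod_i\underline{\mathcal C}(X,X^{\otimes n_i})\xrightarrow{\mathrm{id}\times T}\underline{\mathcal C}(X,X^{\otimes r})\times\underline{\mathcal C}(X^{\otimes r},X^{\otimes(n_1+\cdots+n_r)})\to\underline{\mathcal C}(X,X^{\otimes(n_1+\cdots+n_r)})$, the last map being composition in $\mathcal C$; $\mathbb S_r$ acts by post-composition with the symmetry isomorphisms of $X^{\otimes r}$ (with the convention making this a right action). A $\mathcal V$-enriched $\mathcal P$-coalgebra is an object $X\in\mathcal C$ with a morphism of operads $\phi_X:\mathcal P\to\mathsf{CoEnd}(X)$ in $\mathcal V$. If $\mathcal P$ is non-unital, the arity $0$ components are forgotten (one uses $\mathsf{CoEnd}(X)$ without its arity $0$ component). Mapping objects: for $\mathcal P$-coalgebras $(X,\phi_X),(Y,\phi_Y)$, $\underline{\mathcal P\text{-}\mathsf{Coalg}}(X,Y)$ is the equaliser in $\mathcal V$ of two maps $f,g:\underline{\mathcal C}(X,Y)\rightrightarrows\prod_{r}\underline{\mathcal V}(\mathcal P(r),\underline{\mathcal C}(X,Y^{\otimes r}))$, where $r$ ranges over $r\ge 0$ (over $r\geq 1$ when arity $0$ is forgotten). The adjoints $\underline{\mathcal C}(X,Y)\times\mathcal P(r)\to\underline{\mathcal C}(X,Y^{\otimes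 r})$ of the $r$-th components are: for $f$, the composite $\underline{\mathcal C}(X,Y)\times\mathcal P(r)\xrightarrow{\mathrm{id}\times\phi_X}\underline{\mathcal C}(X,Y)\times\underline{\mathcal C}(X,X^{\otimes r})\xrightarrow{\Delta^{(r)}\times\mathrm{id}}\underline{\mathcal C}(X,Y)^{\times r}\times\underline{\mathcal C}(X,X^{\otimes r})\xrightarrow{T\times\mathrm{id}}\underline{\mathcal C}(X^{\otimes r},Y^{\otimes r})\times\underline{\mathcal C}(X,X^{\otimes r})\xrightarrow{c}\underline{\mathcal C}(X,Y^{\otimes r})$, with $\Delta^{(r)}$ the $r$-fold diagonal; for $g$, the composite $\underline{\mathcal C}(X,Y)\times\mathcal P(r)\xrightarrow{\mathrm{id}\times\phi_Y}\underline{\mathcal C}(X,Y)\times\underline{\mathcal C}(Y,Y^{\otimes r})\xrightarrow{c}\underline{\mathcal C}(X,Y^{\otimes r})$. *)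

theory Defs
  imports "HOL-Combinatorics.Permutations" "HOL-Library.FuncSet"
begin

section \<open>Categories, limits, completeness\<close>

record ('o, 'a) cat =
  Obj :: "'o set"
  Arr :: "'a set"
  Dom :: "'a \<Rightarrow> 'o"
  Cod :: "'a \<Rightarrow> 'o"
  Id :: "'o \<Rightarrow> 'a"
  Comp :: "'a \<Rightarrow> 'a \<Rightarrow> 'a"  (infixr "\<bullet>\<index>" 70)

definition Hom :: "('o, 'a, 'z) cat_scheme \<Rightarrow> 'o \<Rightarrow> 'o \<Rightarrow> 'a set" where
  "Hom V A B = {f \<in> Arr V. Dom V f = A \<and> Cod V f = B}"

locale category =
  fixes V :: "('o, 'a, 'z) cat_scheme" (structure)
  assumes dom_cod: "f \<in> Arr V \<Longrightarrow> Dom V f \<in> Obj V \<and> Cod V f \<in> Obj V"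
    and id_hom: "A \<in> Obj V \<Longrightarrow> Id V A \<in> Hom V A A"
    and comp_hom: "\<lbrakk>f \<in> Hom V A B; g \<in> Hom V B C\<rbrakk> \<Longrightarrow> g \<bullet> f \<in> Hom V A C"
    and comp_assoc:
      "\<lbrakk>f \<in> Hom V A B; g \<in> Hom V B C; h \<in> Hom V C D\<rbrakk> \<Longrightarrow> (h \<bullet> g) \<bullet> f = h \<bullet> (g \<bullet> f)"
    and id_left: "f \<in> Hom V A B \<Longrightarrow> Id V B \<bullet> f = f"
    and id_right: "f \<in> Hom V A B \<Longrightarrow> f \<bullet> Id V A = f"

definition opposite :: "('o, 'a, 'z) cat_scheme \<Rightarrow> ('o, 'a) cat" where
  "opposite V = \<lparr>Obj = Obj V, Arr = Arr V, Dom = Cod V, Cod = Dom V, Id = Id V,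
     Comp = (\<lambda>g f. f \<bullet>\<^bsub>V\<^esub> g)\<rparr>"

definition are_inverse :: "('o, 'a, 'z) cat_scheme \<Rightarrow> 'a \<Rightarrow> 'a \<Rightarrow> bool" where
  "are_inverse V f g \<longleftrightarrow> f \<in> Arr V \<and> g \<in> Hom V (Cod V f) (Dom V f) \<and>
     g \<bullet>\<^bsub>V\<^esub> f = Id V (Dom V f) \<and> f \<bullet>\<^bsub>V\<^esub> g = Id V (Cod V f)"

definition is_iso :: "('o, 'a, 'z) cat_scheme \<Rightarrow> 'a \<Rightarrow> bool" where
  "is_iso V f \<longleftrightarrow> (\<exists>g. are_inverse V f g)"

definition inverse_arrow :: "('o, 'a, 'z) cat_scheme \<Rightarrow> 'a \<Rightarrow> 'a" where
  "inverse_arrow V f = (THE g. are_inverse V f g)"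

definition is_functor ::
  "('j, 'k, 'y) cat_scheme \<Rightarrow> ('o, 'a, 'z) cat_scheme \<Rightarrow> ('j \<Rightarrow> 'o) \<Rightarrow> ('k \<Rightarrow> 'a) \<Rightarrow> bool" where
  "is_functor J V F0 F1 \<longleftrightarrow>
     (\<forall>i\<in>Obj J. F0 i \<in> Obj V \<and> F1 (Id J i) = Id V (F0 i)) \<and>
     (\<forall>u\<in>Arr J. F1 u \<in> Hom V (F0 (Dom J u)) (F0 (Cod J u))) \<and>
     (\<forall>u\<in>Arr J. \<forall>v\<in>Arr J. Dom J v = Cod J u \<longrightarrow> F1 (v \<bullet>\<^bsub>J\<^esub> u) = F1 v \<bullet>\<^bsub>V\<^esub> F1 u)"

definition is_cone ::
  "('j, 'k, 'y) cat_scheme \<Rightarrow> ('o, 'a, 'z) cat_scheme \<Rightarrow> ('j \<Rightarrow> 'o) \<Rightarrow> ('k \<Rightarrow> 'a) \<Rightarrow>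
   'o \<Rightarrow> ('j \<Rightarrow> 'a) \<Rightarrow> bool" where
  "is_cone J V F0 F1 L p \<longleftrightarrow> L \<in> Obj V \<and> (\<forall>i\<in>Obj J. p i \<in> Hom V L (F0 i)) \<and>
     (\<forall>u\<in>Arr J. F1 u \<bullet>\<^bsub>V\<^esub> p (Dom J u) = p (Cod J u))"

definition is_limit ::
  "('j, 'k, 'y) cat_scheme \<Rightarrow> ('o, 'a, 'z) cat_scheme \<Rightarrow> ('j \<Rightarrow> 'o) \<Rightarrow> ('k \<Rightarrow> 'a) \<Rightarrow>
   'o \<Rightarrow> ('j \<Rightarrow> 'a) \<Rightarrow> bool" where
  "is_limit J V F0 F1 L p \<longleftrightarrow> is_cone J V F0 F1 L p \<and>
     (\<forall>K q. is_cone J V F0 F1 K q \<longrightarrow>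
        (\<exists>!h. h \<in> Hom V K L \<and> (\<forall>i\<in>Obj J. p i \<bullet>\<^bsub>V\<^esub> h = q i)))"

text \<open>
  The type \<open>'u\<close> plays the role of the universe: a category is small if its objects and its
  arrows are elements of \<open>'u\<close>.  If \<open>'u\<close> is infinite, all finite and countable diagrams (up to
  isomorphism of the index category) are included.
\<close>

definition complete_category :: "'u itself \<Rightarrow> ('o, 'a, 'z) cat_scheme \<Rightarrow> bool" where
  "complete_category U V \<longleftrightarrow>
     (\<forall>(J :: ('u, 'u) cat) F0 F1. category J \<and> is_functor J V F0 F1 \<longrightarrow>
        (\<exists>L p. is_limit J V F0 F1 L p))"

definition cocomplete_category :: "'u itself \<Rightarrow> ('o, 'a, 'z) cat_scheme \<Rightarrow> bool" where
  "cocomplete_category U V \<longleftrightarrow> complete_category U (opposite V)"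

definition is_terminal :: "('o, 'a, 'z) cat_scheme \<Rightarrow> 'o \<Rightarrow> bool" where
  "is_terminal V T \<longleftrightarrow> T \<in> Obj V \<and> (\<forall>A\<in>Obj V. \<exists>!f. f \<in> Hom V A T)"

definition is_product ::
  "('o, 'a, 'z) cat_scheme \<Rightarrow> 'i set \<Rightarrow> ('i \<Rightarrow> 'o) \<Rightarrow> 'o \<Rightarrow> ('i \<Rightarrow> 'a) \<Rightarrow> bool" where
  "is_product V I F L p \<longleftrightarrow> L \<in> Obj V \<and> (\<forall>i\<in>I. p i \<in> Hom V L (F i)) \<and>
     (\<forall>K\<in>Obj V. \<forall>q. (\<forall>i\<in>I. q i \<in> Hom V K (F i)) \<longrightarrow>
        (\<exists>!h. h \<in> Hom V K L \<and> (\<forall>i\<in>I. p i \<bullet>\<^bsub>V\<^esub> h = q i)))"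

definition is_equaliser ::
  "('o, 'a, 'z) cat_scheme \<Rightarrow> 'a \<Rightarrow> 'a \<Rightarrow> 'o \<Rightarrow> 'a \<Rightarrow> bool" where
  "is_equaliser V f g E e \<longleftrightarrow> e \<in> Hom V E (Dom V f) \<and> f \<bullet>\<^bsub>V\<^esub> e = g \<bullet>\<^bsub>V\<^esub> e \<and>
     (\<forall>K. \<forall>k \<in> Hom V K (Dom V f). f \<bullet>\<^bsub>V\<^esub> k = g \<bullet>\<^bsub>V\<^esub> k \<longrightarrow>
        (\<exists>!h. h \<in> Hom V K E \<and> e \<bullet>\<^bsub>V\<^esub> h = k))"

section \<open>Cartesian closed categories\<close>

text \<open>
  \<open>IHom V A B\<close> is the internal hom, with evaluation
  \<open>Ev V A B : IHom V A B \<times> A \<rightarrow> B\<close>.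
\<close>

record ('o, 'a) ccc = "('o, 'a) cat" +
  One :: 'o
  Prod :: "'o \<Rightarrow> 'o \<Rightarrow> 'o"
  Pr1 :: "'o \<Rightarrow> 'o \<Rightarrow> 'a"
  Pr2 :: "'o \<Rightarrow> 'o \<Rightarrow> 'a"
  IHom :: "'o \<Rightarrow> 'o \<Rightarrow> 'o"
  Ev :: "'o \<Rightarrow> 'o \<Rightarrow> 'a"

definition bang :: "('o, 'a) ccc \<Rightarrow> 'o \<Rightarrow> 'a" where
  "bang V A = (THE f. f \<in> Hom V A (One V))"

definition pair :: "('o, 'a) ccc \<Rightarrow> 'a \<Rightarrow> 'a \<Rightarrow> 'a" where
  "pair V f g = (THE h. h \<in> Hom V (Dom V f) (Prod V (Cod V f) (Cod V g)) \<and>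
     Pr1 V (Cod V f) (Cod V g) \<bullet>\<^bsub>V\<^esub> h = f \<and> Pr2 V (Cod V f) (Cod V g) \<bullet>\<^bsub>V\<^esub> h = g)"

definition pmap :: "('o, 'a) ccc \<Rightarrow> 'a \<Rightarrow> 'a \<Rightarrow> 'a" where
  "pmap V f g = pair V (f \<bullet>\<^bsub>V\<^esub> Pr1 V (Dom V f) (Dom V g)) (g \<bullet>\<^bsub>V\<^esub> Pr2 V (Dom V f) (Dom V g))"

definition swap :: "('o, 'a) ccc \<Rightarrow> 'o \<Rightarrow> 'o \<Rightarrow> 'a" where
  "swap V A B = pair V (Pr2 V A B) (Pr1 V A B)"

definition assoc :: "('o, 'a) ccc \<Rightarrow> 'o \<Rightarrow> 'o \<Rightarrow> 'o \<Rightarrow> 'a" where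
  "assoc V A B C = pair V (Pr1 V A B \<bullet>\<^bsub>V\<^esub> Pr1 V (Prod V A B) C)
     (pair V (Pr2 V A B \<bullet>\<^bsub>V\<^esub> Pr1 V (Prod V A B) C) (Pr2 V (Prod V A B) C))"

definition curry :: "('o, 'a) ccc \<Rightarrow> 'o \<Rightarrow> 'o \<Rightarrow> 'o \<Rightarrow> 'a \<Rightarrow> 'a" where
  "curry V D A B f =
     (THE h. h \<in> Hom V D (IHom V A B) \<and> Ev V A B \<bullet>\<^bsub>V\<^esub> pmap V h (Id V A) = f)"

locale cartesian_closed_category = category V for V :: "('o, 'a) ccc" (structure) +
  assumes one_terminal: "is_terminal V (One V)"
    and prod_obj: "\<lbrakk>A \<in> Obj V; B \<in> Obj V\<rbrakk> \<Longrightarrow> Prod V A B \<in> Obj V"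
    and pr1_hom: "\<lbrakk>A \<in> Obj V; B \<in> Obj V\<rbrakk> \<Longrightarrow> Pr1 V A B \<in> Hom V (Prod V A B) A"
    and pr2_hom: "\<lbrakk>A \<in> Obj V; B \<in> Obj V\<rbrakk> \<Longrightarrow> Pr2 V A B \<in> Hom V (Prod V A B) B"
    and prod_universal: "\<lbrakk>f \<in> Hom V D A; g \<in> Hom V D B\<rbrakk> \<Longrightarrow>
      \<exists>!h. h \<in> Hom V D (Prod V A B) \<and> Pr1 V A B \<bullet> h = f \<and> Pr2 V A B \<bullet> h = g"
    and ihom_obj: "\<lbrakk>A \<in> Obj V; B \<in> Obj V\<rbrakk> \<Longrightarrow> IHom V A B \<in> Obj V"
    and ev_hom: "\<lbrakk>A \<in> Obj V; B \<in> Obj V\<rbrakk> \<Longrightarrow> Ev V A B \<in> Hom V (Prod V (IHom V A B) A) B"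
    and ihom_universal: "\<lbrakk>D \<in> Obj V; A \<in> Obj V; B \<in> Obj V; f \<in> Hom V (Prod V D A) B\<rbrakk> \<Longrightarrow>
      \<exists>!h. h \<in> Hom V D (IHom V A B) \<and> Ev V A B \<bullet> pmap V h (Id V A) = f"

text \<open>
  Finite products of lists of objects are right nested and end in \<open>One V\<close>, so the product of
  \<open>[A]\<close> is \<open>A \<times> 1\<close>.  All reindexings between finite products are expressed by projections and
  tupling.
\<close>

fun Prods :: "('o, 'a) ccc \<Rightarrow> 'o list \<Rightarrow> 'o" where
  "Prods V [] = One V"
| "Prods V (A # As) = Prod V A (Prods V As)"

fun Proj :: "('o, 'a) ccc \<Rightarrow> 'o list \<Rightarrow> nat \<Rightarrow> 'a" where
  "Proj V (A # As) 0 = Pr1 V A (Prods V As)"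
| "Proj V (A # As) (Suc i) = Proj V As i \<bullet>\<^bsub>V\<^esub> Pr2 V A (Prods V As)"
| "Proj V [] i = undefined"

text \<open>\<open>tuple V D fs\<close> is the arrow with components \<open>fs\<close>, all of which have domain \<open>D\<close>.\<close>

fun tuple :: "('o, 'a) ccc \<Rightarrow> 'o \<Rightarrow> 'a list \<Rightarrow> 'a" where
  "tuple V D [] = bang V D"
| "tuple V D (f # fs) = pair V f (tuple V D fs)"

definition diag :: "('o, 'a) ccc \<Rightarrow> nat \<Rightarrow> 'o \<Rightarrow> 'a" where
  "diag V r A = tuple V A (replicate r (Id V A))"

definition flatten :: "('o, 'a) ccc \<Rightarrow> 'o list list \<Rightarrow> 'a" where
  "flatten V Ass = tuple V (Prods V (map (Prods V) Ass))
     (concat (map (\<lambda>i. map (\<lambda>j. Proj V (Ass ! i) j \<bullet>\<^bsub>V\<^esub> Proj V (map (Prods V) Ass) i)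
        [0..<length (Ass ! i)]) [0..<length Ass]))"

section \<open>Enriched categories\<close>

text \<open>\<open>EComp C X Y Z : EHom C Y Z \<times> EHom C X Y \<rightarrow> EHom C X Z\<close> and \<open>EId C X : 1 \<rightarrow> EHom C X X\<close>.\<close>

record ('c, 'o, 'a) vcat =
  EObj :: "'c set"
  EHom :: "'c \<Rightarrow> 'c \<Rightarrow> 'o"
  EComp :: "'c \<Rightarrow> 'c \<Rightarrow> 'c \<Rightarrow> 'a"
  EId :: "'c \<Rightarrow> 'a"

locale V_category = cartesian_closed_category V
  for V :: "('o, 'a) ccc" (structure) and C :: "('c, 'o, 'a, 'z) vcat_scheme" +
  assumes ehom_obj: "\<lbrakk>X \<in> EObj C; Y \<in> EObj C\<rbrakk> \<Longrightarrow> EHom C X Y \<in> Obj V"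
    and ecomp_hom: "\<lbrakk>X \<in> EObj C; Y \<in> EObj C; Z \<in> EObj C\<rbrakk> \<Longrightarrow>
      EComp C X Y Z \<in> Hom V (Prod V (EHom C Y Z) (EHom C X Y)) (EHom C X Z)"
    and eid_hom: "X \<in> EObj C \<Longrightarrow> EId C X \<in> Hom V (One V) (EHom C X X)"
    and ecomp_assoc: "\<lbrakk>W \<in> EObj C; X \<in> EObj C; Y \<in> EObj C; Z \<in> EObj C\<rbrakk> \<Longrightarrow>
      EComp C W X Z \<bullet> pmap V (EComp C X Y Z) (Id V (EHom C W X)) =
      EComp C W Y Z \<bullet> pmap V (Id V (EHom C Y Z)) (EComp C W X Y)
        \<bullet> assoc V (EHom C Y Z) (EHom C X Y) (EHom C W X)"
    and eid_right: "\<lbrakk>X \<in> EObj C; Y \<in> EObj C\<rbrakk> \<Longrightarrow>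
      EComp C X X Y \<bullet> pmap V (Id V (EHom C X Y)) (EId C X) = Pr1 V (EHom C X Y) (One V)"
    and eid_left: "\<lbrakk>X \<in> EObj C; Y \<in> EObj C\<rbrakk> \<Longrightarrow>
      EComp C X Y Y \<bullet> pmap V (EId C Y) (Id V (EHom C X Y)) = Pr2 V (One V) (EHom C X Y)"

definition V_functor ::
  "('o, 'a) ccc \<Rightarrow> ('c, 'o, 'a, 'y) vcat_scheme \<Rightarrow> ('d, 'o, 'a, 'z) vcat_scheme \<Rightarrow>
   ('c \<Rightarrow> 'd) \<Rightarrow> ('c \<Rightarrow> 'c \<Rightarrow> 'a) \<Rightarrow> bool" where
  "V_functor V C D F0 F1 \<longleftrightarrow>
     (\<forall>X\<in>EObj C. F0 X \<in> EObj D) \<and>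
     (\<forall>X\<in>EObj C. \<forall>Y\<in>EObj C. F1 X Y \<in> Hom V (EHom C X Y) (EHom D (F0 X) (F0 Y))) \<and>
     (\<forall>X\<in>EObj C. \<forall>Y\<in>EObj C. \<forall>Z\<in>EObj C.
        F1 X Z \<bullet>\<^bsub>V\<^esub> EComp C X Y Z =
        EComp D (F0 X) (F0 Y) (F0 Z) \<bullet>\<^bsub>V\<^esub> pmap V (F1 Y Z) (F1 X Y)) \<and>
     (\<forall>X\<in>EObj C. F1 X X \<bullet>\<^bsub>V\<^esub> EId C X = EId D (F0 X))"

text \<open>
  The underlying ordinary category; an arrow \<open>X \<rightarrow> Y\<close> is a triple \<open>(X, a, Y)\<close> with
  \<open>a : 1 \<rightarrow> EHom C X Y\<close> in \<open>V\<close>.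
\<close>

definition underlying :: "('o, 'a) ccc \<Rightarrow> ('c, 'o, 'a, 'z) vcat_scheme \<Rightarrow> ('c, 'c \<times> 'a \<times> 'c) cat"
  where
  "underlying V C = \<lparr>
     Obj = EObj C,
     Arr = {(X, a, Y). X \<in> EObj C \<and> Y \<in> EObj C \<and> a \<in> Hom V (One V) (EHom C X Y)},
     Dom = (\<lambda>(X, a, Y). X),
     Cod = (\<lambda>(X, a, Y). Y),
     Id = (\<lambda>X. (X, EId C X, X)),
     Comp = (\<lambda>(Y', b, Z) (X, a, Y). (X, EComp C X Y Z \<bullet>\<^bsub>V\<^esub> pair V b a, Z))\<rparr>"

text \<open>The map \<open>EHom C W X \<rightarrow> EHom C W Y\<close> given by post-composition with \<open>u : X \<rightarrow> Y\<close>.\<close>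

definition postcomp ::
  "('o, 'a) ccc \<Rightarrow> ('c, 'o, 'a, 'z) vcat_scheme \<Rightarrow> 'c \<Rightarrow> 'c \<times> 'a \<times> 'c \<Rightarrow> 'a" where
  "postcomp V C W u = (case u of (X, a, Y) \<Rightarrow>
     EComp C W X Y \<bullet>\<^bsub>V\<^esub> pair V (a \<bullet>\<^bsub>V\<^esub> bang V (EHom C W X)) (Id V (EHom C W X)))"

definition V_nat_iso ::
  "('o, 'a) ccc \<Rightarrow> ('c, 'o, 'a, 'y) vcat_scheme \<Rightarrow> ('d, 'o, 'a, 'z) vcat_scheme \<Rightarrow>
   ('c \<Rightarrow> 'd) \<Rightarrow> ('c \<Rightarrow> 'c \<Rightarrow> 'a) \<Rightarrow> ('c \<Rightarrow> 'd) \<Rightarrow> ('c \<Rightarrow> 'c \<Rightarrow> 'a) \<Rightarrow> ('c \<Rightarrow> 'a) \<Rightarrow> bool" where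
  "V_nat_iso V C D F0 F1 G0 G1 t \<longleftrightarrow>
     V_functor V C D F0 F1 \<and> V_functor V C D G0 G1 \<and>
     (\<forall>X\<in>EObj C. t X \<in> Hom V (One V) (EHom D (F0 X) (G0 X)) \<and>
        is_iso (underlying V D) (F0 X, t X, G0 X)) \<and>
     (\<forall>X\<in>EObj C. \<forall>Y\<in>EObj C.
        EComp D (F0 X) (G0 X) (G0 Y)
          \<bullet>\<^bsub>V\<^esub> pair V (G1 X Y) (t X \<bullet>\<^bsub>V\<^esub> bang V (EHom C X Y)) =
        EComp D (F0 X) (F0 Y) (G0 Y)
          \<bullet>\<^bsub>V\<^esub> pair V (t Y \<bullet>\<^bsub>V\<^esub> bang V (EHom C X Y)) (F1 X Y))"

definition vcat_tensor ::
  "('o, 'a) ccc \<Rightarrow> ('c, 'o, 'a, 'y) vcat_scheme \<Rightarrow> ('d, 'o, 'a, 'z) vcat_scheme \<Rightarrow>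
   ('c \<times> 'd, 'o, 'a) vcat" where
  "vcat_tensor V C D = \<lparr>
     EObj = EObj C \<times> EObj D,
     EHom = (\<lambda>(X, X') (Y, Y'). Prod V (EHom C X Y) (EHom D X' Y')),
     EComp = (\<lambda>(X, X') (Y, Y') (Z, Z').
       pair V
         (EComp C X Y Z \<bullet>\<^bsub>V\<^esub>
            pmap V (Pr1 V (EHom C Y Z) (EHom D Y' Z')) (Pr1 V (EHom C X Y) (EHom D X' Y')))
         (EComp D X' Y' Z' \<bullet>\<^bsub>V\<^esub>
            pmap V (Pr2 V (EHom C Y Z) (EHom D Y' Z')) (Pr2 V (EHom C X Y) (EHom D X' Y')))),
     EId = (\<lambda>(X, X'). pair V (EId C X) (EId D X'))\<rparr>"

section \<open>Symmetric monoidal enriched categories\<close>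

text \<open>
  \<open>TenHom C A B A' B' : EHom C A A' \<times> EHom C B B' \<rightarrow> EHom C (A \<otimes> B) (A' \<otimes> B')\<close>.  The
  structure isomorphisms are \<open>(A \<otimes> B) \<otimes> D \<rightarrow> A \<otimes> (B \<otimes> D)\<close>, \<open>1 \<otimes> A \<rightarrow> A\<close>, \<open>A \<otimes> 1 \<rightarrow> A\<close> and
  \<open>A \<otimes> B \<rightarrow> B \<otimes> A\<close>.  A \<open>V\<close>-functor from the unit \<open>V\<close>-category is the same as an object, which
  is why the unit of the pseudomonoid is given by \<open>Unit C\<close> alone.
\<close>

record ('c, 'o, 'a) smvcat = "('c, 'o, 'a) vcat" +
  Unit :: 'c
  Ten :: "'c \<Rightarrow> 'c \<Rightarrow> 'c"
  TenHom :: "'c \<Rightarrow> 'c \<Rightarrow> 'c \<Rightarrow> 'c \<Rightarrow> 'a"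
  AssocC :: "'c \<Rightarrow> 'c \<Rightarrow> 'c \<Rightarrow> 'a"
  LUnitC :: "'c \<Rightarrow> 'a"
  RUnitC :: "'c \<Rightarrow> 'a"
  SymC :: "'c \<Rightarrow> 'c \<Rightarrow> 'a"

text \<open>The tensor product and the structure isomorphisms, as arrows of the underlying category.\<close>

definition uten ::
  "('o, 'a) ccc \<Rightarrow> ('c, 'o, 'a) smvcat \<Rightarrow> 'c \<times> 'a \<times> 'c \<Rightarrow> 'c \<times> 'a \<times> 'c \<Rightarrow> 'c \<times> 'a \<times> 'c" where
  "uten V C u v = (case (u, v) of ((A, a, A'), (B, b, B')) \<Rightarrow>
     (Ten C A B, TenHom C A B A' B' \<bullet>\<^bsub>V\<^esub> pair V a b, Ten C A' B'))"

definition uassoc :: "('c, 'o, 'a) smvcat \<Rightarrow> 'c \<Rightarrow> 'c \<Rightarrow> 'c \<Rightarrow> 'c \<times> 'a \<times> 'c" where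
  "uassoc C A B D = (Ten C (Ten C A B) D, AssocC C A B D, Ten C A (Ten C B D))"

definition ulunit :: "('c, 'o, 'a) smvcat \<Rightarrow> 'c \<Rightarrow> 'c \<times> 'a \<times> 'c" where
  "ulunit C A = (Ten C (Unit C) A, LUnitC C A, A)"

definition urunit :: "('c, 'o, 'a) smvcat \<Rightarrow> 'c \<Rightarrow> 'c \<times> 'a \<times> 'c" where
  "urunit C A = (Ten C A (Unit C), RUnitC C A, A)"

definition usym :: "('c, 'o, 'a) smvcat \<Rightarrow> 'c \<Rightarrow> 'c \<Rightarrow> 'c \<times> 'a \<times> 'c" where
  "usym C A B = (Ten C A B, SymC C A B, Ten C B A)"

locale symmetric_monoidal_V_category = V_category V C
  for V :: "('o, 'a) ccc" (structure) and C :: "('c, 'o, 'a) smvcat" +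
  assumes unit_obj: "Unit C \<in> EObj C"
    and ten_functor:
      "V_functor V (vcat_tensor V C C) C (\<lambda>(A, B). Ten C A B) (\<lambda>(A, B) (A', B'). TenHom C A B A' B')"
    and assoc_nat: "V_nat_iso V (vcat_tensor V (vcat_tensor V C C) C) C
      (\<lambda>((A, B), D). Ten C (Ten C A B) D)
      (\<lambda>((A, B), D) ((A', B'), D'). TenHom C (Ten C A B) D (Ten C A' B') D'
         \<bullet> pmap V (TenHom C A B A' B') (Id V (EHom C D D')))
      (\<lambda>((A, B), D). Ten C A (Ten C B D))
      (\<lambda>((A, B), D) ((A', B'), D'). TenHom C A (Ten C B D) A' (Ten C B' D')
         \<bullet> pmap V (Id V (EHom C A A')) (TenHom C B D B' D')
         \<bullet> assoc V (EHom C A A') (EHom C B B') (EHom C D D'))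
      (\<lambda>((A, B), D). AssocC C A B D)"
    and lunit_nat: "V_nat_iso V C C
      (\<lambda>A. Ten C (Unit C) A)
      (\<lambda>A B. TenHom C (Unit C) A (Unit C) B
         \<bullet> pair V (EId C (Unit C) \<bullet> bang V (EHom C A B)) (Id V (EHom C A B)))
      (\<lambda>A. A) (\<lambda>A B. Id V (EHom C A B)) (LUnitC C)"
    and runit_nat: "V_nat_iso V C C
      (\<lambda>A. Ten C A (Unit C))
      (\<lambda>A B. TenHom C A (Unit C) B (Unit C)
         \<bullet> pair V (Id V (EHom C A B)) (EId C (Unit C) \<bullet> bang V (EHom C A B)))
      (\<lambda>A. A) (\<lambda>A B. Id V (EHom C A B)) (RUnitC C)"
    and sym_nat: "V_nat_iso V (vcat_tensor V C C) C
      (\<lambda>(A, B). Ten C A B) (\<lambda>(A, B) (A', B'). TenHom C A B A' B')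
      (\<lambda>(A, B). Ten C B A)
      (\<lambda>(A, B) (A', B'). TenHom C B A B' A' \<bullet> swap V (EHom C A A') (EHom C B B'))
      (\<lambda>(A, B). SymC C A B)"
    and pentagon: "\<lbrakk>A \<in> EObj C; B \<in> EObj C; D \<in> EObj C; E \<in> EObj C\<rbrakk> \<Longrightarrow>
      uassoc C A B (Ten C D E) \<bullet>\<^bsub>underlying V C\<^esub> uassoc C (Ten C A B) D E =
      uten V C (Id (underlying V C) A) (uassoc C B D E)
        \<bullet>\<^bsub>underlying V C\<^esub> uassoc C A (Ten C B D) E
        \<bullet>\<^bsub>underlying V C\<^esub> uten V C (uassoc C A B D) (Id (underlying V C) E)"
    and triangle: "\<lbrakk>A \<in> EObj C; B \<in> EObj C\<rbrakk> \<Longrightarrow>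
      uten V C (Id (underlying V C) A) (ulunit C B) \<bullet>\<^bsub>underlying V C\<^esub> uassoc C A (Unit C) B =
      uten V C (urunit C A) (Id (underlying V C) B)"
    and hexagon: "\<lbrakk>A \<in> EObj C; B \<in> EObj C; D \<in> EObj C\<rbrakk> \<Longrightarrow>
      uassoc C B D A \<bullet>\<^bsub>underlying V C\<^esub> usym C A (Ten C B D) \<bullet>\<^bsub>underlying V C\<^esub> uassoc C A B D =
      uten V C (Id (underlying V C) B) (usym C A D)
        \<bullet>\<^bsub>underlying V C\<^esub> uassoc C B A D
        \<bullet>\<^bsub>underlying V C\<^esub> uten V C (usym C A B) (Id (underlying V C) D)"
    and symmetry: "\<lbrakk>A \<in> EObj C; B \<in> EObj C\<rbrakk> \<Longrightarrow>
      usym C B A \<bullet>\<^bsub>underlying V C\<^esub> usym C A B = Id (underlying V C) (Ten C A B)"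

text \<open>
  Iterated tensor products are right nested: the tensor of \<open>[]\<close> is the unit and that of \<open>[A]\<close>
  is \<open>A\<close> itself.
\<close>

fun tens :: "('c, 'o, 'a) smvcat \<Rightarrow> 'c list \<Rightarrow> 'c" where
  "tens C [] = Unit C"
| "tens C [A] = A"
| "tens C (A # B # As) = Ten C A (tens C (B # As))"

definition tpow :: "('c, 'o, 'a) smvcat \<Rightarrow> 'c \<Rightarrow> nat \<Rightarrow> 'c" where
  "tpow C X r = tens C (replicate r X)"

text \<open>
  The map \<open>T : EHom C A\<^sub>1 B\<^sub>1 \<times> \<dots> \<times> EHom C A\<^sub>r B\<^sub>r \<rightarrow> EHom C (A\<^sub>1 \<otimes> \<dots> \<otimes> A\<^sub>r) (B\<^sub>1 \<otimes> \<dots> \<otimes> B\<^sub>r)\<close> for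
  the list of pairs \<open>[(A\<^sub>1, B\<^sub>1), \<dots>, (A\<^sub>r, B\<^sub>r)]\<close>.
\<close>

fun tens_hom :: "('o, 'a) ccc \<Rightarrow> ('c, 'o, 'a) smvcat \<Rightarrow> ('c \<times> 'c) list \<Rightarrow> 'a" where
  "tens_hom V C [] = EId C (Unit C)"
| "tens_hom V C [(A, B)] = Pr1 V (EHom C A B) (One V)"
| "tens_hom V C ((A, B) # p # ps) =
     TenHom C A (tens C (map fst (p # ps))) B (tens C (map snd (p # ps)))
       \<bullet>\<^bsub>V\<^esub> pmap V (Id V (EHom C A B)) (tens_hom V C (p # ps))"

text \<open>
  The canonical isomorphisms \<open>X\<^sup>m \<otimes> X\<^sup>n \<rightarrow> X\<^sup>m\<^sup>+\<^sup>n\<close> and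
  \<open>X\<^sup>n\<^sup>1 \<otimes> \<dots> \<otimes> X\<^sup>n\<^sup>k \<rightarrow> X\<^sup>n\<^sup>1\<^sup>+\<^sup>\<dots>\<^sup>+\<^sup>n\<^sup>k\<close> of tensor powers.
\<close>

fun pow_mult ::
  "('o, 'a) ccc \<Rightarrow> ('c, 'o, 'a) smvcat \<Rightarrow> 'c \<Rightarrow> nat \<Rightarrow> nat \<Rightarrow> 'c \<times> 'a \<times> 'c" where
  "pow_mult V C X 0 n = ulunit C (tpow C X n)"
| "pow_mult V C X (Suc 0) 0 = urunit C X"
| "pow_mult V C X (Suc 0) (Suc n) = Id (underlying V C) (Ten C X (tpow C X (Suc n)))"
| "pow_mult V C X (Suc (Suc m)) n =
     uten V C (Id (underlying V C) X) (pow_mult V C X (Suc m) n)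
       \<bullet>\<^bsub>underlying V C\<^esub> uassoc C X (tpow C X (Suc m)) (tpow C X n)"

fun pow_merge :: "('o, 'a) ccc \<Rightarrow> ('c, 'o, 'a) smvcat \<Rightarrow> 'c \<Rightarrow> nat list \<Rightarrow> 'c \<times> 'a \<times> 'c" where
  "pow_merge V C X [] = Id (underlying V C) (Unit C)"
| "pow_merge V C X [n] = Id (underlying V C) (tpow C X n)"
| "pow_merge V C X (n # n' # ns) =
     pow_mult V C X n (sum_list (n' # ns))
       \<bullet>\<^bsub>underlying V C\<^esub> uten V C (Id (underlying V C) (tpow C X n)) (pow_merge V C X (n' # ns))"

text \<open>
  Symmetry isomorphisms of tensor powers, described below by their effect on
  \<open>x\<^sub>0 \<otimes> \<dots> \<otimes> x\<^sub>r\<^sub>-\<^sub>1\<close>.  \<open>swap2 V C X n\<close> exchanges the first two factors of \<open>X\<^sup>n\<^sup>+\<^sup>2\<close>;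
  \<open>to_front V C X r i\<close> moves \<open>x\<^sub>i\<close> to the front and leaves the order of the other factors
  unchanged; \<open>sym_iso V C X r \<pi>\<close> produces \<open>x\<^sub>\<pi>\<^sub>0 \<otimes> \<dots> \<otimes> x\<^sub>\<pi>\<^sub>(\<^sub>r\<^sub>-\<^sub>1\<^sub>)\<close>, for a permutation \<open>\<pi>\<close> of
  \<open>{..<r}\<close>.  Thus \<open>sym_iso \<pi> \<bullet> sym_iso \<rho> = sym_iso (\<rho> \<circ> \<pi>)\<close>, so that post-composition is a
  right action.
\<close>

fun swap2 :: "('o, 'a) ccc \<Rightarrow> ('c, 'o, 'a) smvcat \<Rightarrow> 'c \<Rightarrow> nat \<Rightarrow> 'c \<times> 'a \<times> 'c" where
  "swap2 V C X 0 = usym C X X"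
| "swap2 V C X (Suc n) =
     uassoc C X X (tpow C X (Suc n))
       \<bullet>\<^bsub>underlying V C\<^esub> uten V C (usym C X X) (Id (underlying V C) (tpow C X (Suc n)))
       \<bullet>\<^bsub>underlying V C\<^esub> inverse_arrow (underlying V C) (uassoc C X X (tpow C X (Suc n)))"

fun to_front ::
  "('o, 'a) ccc \<Rightarrow> ('c, 'o, 'a) smvcat \<Rightarrow> 'c \<Rightarrow> nat \<Rightarrow> nat \<Rightarrow> 'c \<times> 'a \<times> 'c" where
  "to_front V C X r 0 = Id (underlying V C) (tpow C X r)"
| "to_front V C X (Suc (Suc n)) (Suc i) =
     swap2 V C X n
       \<bullet>\<^bsub>underlying V C\<^esub> uten V C (Id (underlying V C) X) (to_front V C X (Suc n) i)"
| "to_front V C X r i = undefined"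

definition perm_tail :: "(nat \<Rightarrow> nat) \<Rightarrow> nat \<Rightarrow> nat" where
  "perm_tail \<pi> k = (if \<pi> (Suc k) < \<pi> 0 then \<pi> (Suc k) else \<pi> (Suc k) - 1)"

fun sym_iso ::
  "('o, 'a) ccc \<Rightarrow> ('c, 'o, 'a) smvcat \<Rightarrow> 'c \<Rightarrow> nat \<Rightarrow> (nat \<Rightarrow> nat) \<Rightarrow> 'c \<times> 'a \<times> 'c" where
  "sym_iso V C X 0 \<pi> = Id (underlying V C) (tpow C X 0)"
| "sym_iso V C X (Suc 0) \<pi> = Id (underlying V C) (tpow C X (Suc 0))"
| "sym_iso V C X (Suc (Suc n)) \<pi> =
     uten V C (Id (underlying V C) X) (sym_iso V C X (Suc n) (perm_tail \<pi>))
       \<bullet>\<^bsub>underlying V C\<^esub> to_front V C X (Suc (Suc n)) (\<pi> 0)"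

section \<open>Operads\<close>

text \<open>
  \<open>OpComp P [n\<^sub>1, \<dots>, n\<^sub>k] : P(k) \<times> P(n\<^sub>1) \<times> \<dots> \<times> P(n\<^sub>k) \<rightarrow> P(n\<^sub>1 + \<dots> + n\<^sub>k)\<close>, and
  \<open>OpAct P n \<pi> : P(n) \<rightarrow> P(n)\<close> is the right action of a permutation \<open>\<pi>\<close> of \<open>{..<n}\<close>.
\<close>

record ('o, 'a) operad_data =
  OpObj :: "nat \<Rightarrow> 'o"
  OpAct :: "nat \<Rightarrow> (nat \<Rightarrow> nat) \<Rightarrow> 'a"
  OpUnit :: 'a
  OpComp :: "nat list \<Rightarrow> 'a"

text \<open>
  \<open>block_pos ns m = (i, t)\<close> if position \<open>m\<close> of the concatenation of blocks of sizes \<open>ns\<close> is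
  position \<open>t\<close> in block \<open>i\<close>.
\<close>

fun block_pos :: "nat list \<Rightarrow> nat \<Rightarrow> nat \<times> nat" where
  "block_pos [] m = (0, m)"
| "block_pos (n # ns) m =
     (if m < n then (0, m) else (case block_pos ns (m - n) of (i, t) \<Rightarrow> (Suc i, t)))"

text \<open>\<open>reindex \<sigma> ns\<close> has \<open>n\<^sub>i\<close> in position \<open>\<sigma> i\<close>.\<close>

definition reindex :: "(nat \<Rightarrow> nat) \<Rightarrow> nat list \<Rightarrow> nat list" where
  "reindex \<sigma> ns = map (\<lambda>j. ns ! inv \<sigma> j) [0..<length ns]"

text \<open>
  \<open>block_perm \<sigma> ns\<close> is the permutation \<open>\<sigma>(n\<^sub>1, \<dots>, n\<^sub>k)\<close>; it sends position \<open>t\<close> of the \<open>i\<close>-th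
  block (for block sizes \<open>ns\<close>) to position \<open>t\<close> of the \<open>\<sigma> i\<close>-th block (for block sizes
  \<open>reindex \<sigma> ns\<close>).
\<close>

definition block_perm :: "(nat \<Rightarrow> nat) \<Rightarrow> nat list \<Rightarrow> nat \<Rightarrow> nat" where
  "block_perm \<sigma> ns m = (if m < sum_list ns
     then (case block_pos ns m of (i, t) \<Rightarrow> sum_list (take (\<sigma> i) (reindex \<sigma> ns)) + t) else m)"

text \<open>The block sum of permutations.\<close>

definition sum_perm :: "(nat \<Rightarrow> nat) list \<Rightarrow> nat list \<Rightarrow> nat \<Rightarrow> nat" where
  "sum_perm \<tau>s ns m = (if m < sum_list ns
     then (case block_pos ns m of (i, t) \<Rightarrow> sum_list (take i ns) + (\<tau>s ! i) t) else m)"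

definition op_dom :: "('o, 'a) ccc \<Rightarrow> ('o, 'a) operad_data \<Rightarrow> nat list \<Rightarrow> 'o" where
  "op_dom V P ns = Prod V (OpObj P (length ns)) (Prods V (map (OpObj P) ns))"

text \<open>
  In the associativity axiom \<open>mss\<close> is the list of lists of inner degrees; both sides are maps
  \<open>P(k) \<times> (\<Prod>\<^sub>s P(n\<^sub>s) \<times> \<Prod>\<^sub>s \<Prod>\<^sub>q P(m\<^sub>s\<^sub>q)) \<rightarrow> P(\<Sum> m\<^sub>s\<^sub>q)\<close>, where \<open>n\<^sub>s\<close> is the length of the \<open>s\<close>-th list.
\<close>

locale operad = cartesian_closed_category V
  for V :: "('o, 'a) ccc" (structure) and P :: "('o, 'a) operad_data" +
  assumes op_obj: "OpObj P n \<in> Obj V"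
    and op_act_hom: "\<pi> permutes {..<n} \<Longrightarrow> OpAct P n \<pi> \<in> Hom V (OpObj P n) (OpObj P n)"
    and op_act_id: "OpAct P n id = Id V (OpObj P n)"
    and op_act_comp: "\<lbrakk>\<pi> permutes {..<n}; \<rho> permutes {..<n}\<rbrakk> \<Longrightarrow>
      OpAct P n (\<rho> \<circ> \<pi>) = OpAct P n \<pi> \<bullet> OpAct P n \<rho>"
    and op_unit_hom: "OpUnit P \<in> Hom V (One V) (OpObj P 1)"
    and op_comp_hom: "OpComp P ns \<in> Hom V (op_dom V P ns) (OpObj P (sum_list ns))"
    and op_assoc: "\<lbrakk>ns = map length mss; A = OpObj P (length ns); B = Prods V (map (OpObj P) ns);
        Ds = map (\<lambda>ms. Prods V (map (OpObj P) ms)) mss; D = Prods V Ds;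
        p = Pr1 V A (Prod V B D);
        q = Pr1 V B D \<bullet> Pr2 V A (Prod V B D);
        r = Pr2 V B D \<bullet> Pr2 V A (Prod V B D)\<rbrakk> \<Longrightarrow>
      OpComp P (concat mss)
        \<bullet> pair V (OpComp P ns \<bullet> pair V p q) (flatten V (map (map (OpObj P)) mss) \<bullet> r) =
      OpComp P (map sum_list mss)
        \<bullet> pair V p (tuple V (Prod V A (Prod V B D))
            (map (\<lambda>i. OpComp P (mss ! i)
                        \<bullet> pair V (Proj V (map (OpObj P) ns) i \<bullet> q) (Proj V Ds i \<bullet> r))
               [0..<length mss]))"
    and op_unit_left:
      "OpComp P [n] \<bullet> pair V (OpUnit P \<bullet> bang V (OpObj P n)) (tuple V (OpObj P n) [Id V (OpObj P n)])
       = Id V (OpObj P n)"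
    and op_unit_right:
      "OpComp P (replicate k 1)
         \<bullet> pair V (Id V (OpObj P k))
             (tuple V (OpObj P k) (replicate k (OpUnit P \<bullet> bang V (OpObj P k))))
       = Id V (OpObj P k)"
    and op_equivariant_outer: "\<lbrakk>k = length ns; \<sigma> permutes {..<k};
        p = Pr1 V (OpObj P k) (Prods V (map (OpObj P) ns));
        q = Pr2 V (OpObj P k) (Prods V (map (OpObj P) ns))\<rbrakk> \<Longrightarrow>
      OpComp P ns \<bullet> pair V (OpAct P k \<sigma> \<bullet> p) q =
      OpAct P (sum_list ns) (block_perm \<sigma> ns) \<bullet> OpComp P (reindex \<sigma> ns)
        \<bullet> pair V p (tuple V (op_dom V P ns)
            (map (\<lambda>j. Proj V (map (OpObj P) ns) (inv \<sigma> j) \<bullet> q) [0..<k]))"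
    and op_equivariant_inner: "\<lbrakk>k = length ns; length \<tau>s = k; \<And>i. i < k \<Longrightarrow> \<tau>s ! i permutes {..<ns ! i};
        p = Pr1 V (OpObj P k) (Prods V (map (OpObj P) ns));
        q = Pr2 V (OpObj P k) (Prods V (map (OpObj P) ns))\<rbrakk> \<Longrightarrow>
      OpComp P ns
        \<bullet> pair V p (tuple V (op_dom V P ns)
            (map (\<lambda>i. OpAct P (ns ! i) (\<tau>s ! i) \<bullet> Proj V (map (OpObj P) ns) i \<bullet> q) [0..<k])) =
      OpAct P (sum_list ns) (sum_perm \<tau>s ns) \<bullet> OpComp P ns"

text \<open>
  \<open>P\<close> is unital if \<open>P(0) = 1\<close>, where the unit object is only determined up to isomorphism.  For
  a non-unital operad the component of arity 0 is forgotten.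
\<close>

definition unital :: "('o, 'a) ccc \<Rightarrow> ('o, 'a) operad_data \<Rightarrow> bool" where
  "unital V P \<longleftrightarrow> is_terminal V (OpObj P 0)"

definition relevant_degrees :: "('o, 'a) ccc \<Rightarrow> ('o, 'a) operad_data \<Rightarrow> nat set" where
  "relevant_degrees V P = (if unital V P then UNIV else {1..})"

definition operad_morphism ::
  "('o, 'a) ccc \<Rightarrow> nat set \<Rightarrow> ('o, 'a) operad_data \<Rightarrow> ('o, 'a) operad_data \<Rightarrow> (nat \<Rightarrow> 'a) \<Rightarrow> bool"
  where
  "operad_morphism V R P Q \<phi> \<longleftrightarrow>
     (\<forall>n\<in>R. \<phi> n \<in> Hom V (OpObj P n) (OpObj Q n)) \<and>
     (\<forall>n\<in>R. \<forall>\<pi>. \<pi> permutes {..<n} \<longrightarrow> \<phi> n \<bullet>\<^bsub>V\<^esub> OpAct P n \<pi> = OpAct Q n \<pi> \<bullet>\<^bsub>V\<^esub> \<phi> n) \<and>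
     \<phi> 1 \<bullet>\<^bsub>V\<^esub> OpUnit P = OpUnit Q \<and>
     (\<forall>ns. length ns \<in> R \<and> set ns \<subseteq> R \<longrightarrow>
        \<phi> (sum_list ns) \<bullet>\<^bsub>V\<^esub> OpComp P ns =
        OpComp Q ns \<bullet>\<^bsub>V\<^esub> pair V
          (\<phi> (length ns) \<bullet>\<^bsub>V\<^esub> Pr1 V (OpObj P (length ns)) (Prods V (map (OpObj P) ns)))
          (tuple V (op_dom V P ns)
             (map (\<lambda>i. \<phi> (ns ! i) \<bullet>\<^bsub>V\<^esub> Proj V (map (OpObj P) ns) i
                        \<bullet>\<^bsub>V\<^esub> Pr2 V (OpObj P (length ns)) (Prods V (map (OpObj P) ns)))
                [0..<length ns])))"

section \<open>Coalgebras over an operad\<close>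

definition CoEnd :: "('o, 'a) ccc \<Rightarrow> ('c, 'o, 'a) smvcat \<Rightarrow> 'c \<Rightarrow> ('o, 'a) operad_data" where
  "CoEnd V C X = \<lparr>
     OpObj = (\<lambda>r. EHom C X (tpow C X r)),
     OpAct = (\<lambda>r \<pi>. postcomp V C X (sym_iso V C X r \<pi>)),
     OpUnit = EId C X,
     OpComp = (\<lambda>ns.
       let k = length ns; Y = tens C (map (tpow C X) ns);
           A = EHom C X (tpow C X k)
       in postcomp V C X (pow_merge V C X ns)
            \<bullet>\<^bsub>V\<^esub> EComp C X (tpow C X k) Y
            \<bullet>\<^bsub>V\<^esub> swap V A (EHom C (tpow C X k) Y)
            \<bullet>\<^bsub>V\<^esub> pmap V (Id V A) (tens_hom V C (map (\<lambda>n. (X, tpow C X n)) ns)))\<rparr>"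

text \<open>
  A coalgebra is a pair \<open>(X, \<phi>)\<close>; extensionality of \<open>\<phi>\<close> makes sure that it carries no data
  outside the relevant degrees.
\<close>

definition coalgebras ::
  "('o, 'a) ccc \<Rightarrow> ('c, 'o, 'a) smvcat \<Rightarrow> ('o, 'a) operad_data \<Rightarrow> ('c \<times> (nat \<Rightarrow> 'a)) set" where
  "coalgebras V C P = {(X, \<phi>). X \<in> EObj C \<and> \<phi> \<in> extensional (relevant_degrees V P) \<and>
     operad_morphism V (relevant_degrees V P) P (CoEnd V C X) \<phi>}"

definition coalg_f ::
  "('o, 'a) ccc \<Rightarrow> ('c, 'o, 'a) smvcat \<Rightarrow> ('o, 'a) operad_data \<Rightarrow>
   'c \<times> (nat \<Rightarrow> 'a) \<Rightarrow> 'c \<times> (nat \<Rightarrow> 'a) \<Rightarrow> nat \<Rightarrow> 'a" where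
  "coalg_f V C P x y r = (case (x, y) of ((X, \<phi>), (Y, \<psi>)) \<Rightarrow>
     EComp C X (tpow C X r) (tpow C Y r)
       \<bullet>\<^bsub>V\<^esub> pmap V (tens_hom V C (replicate r (X, Y))) (Id V (EHom C X (tpow C X r)))
       \<bullet>\<^bsub>V\<^esub> pmap V (diag V r (EHom C X Y)) (Id V (EHom C X (tpow C X r)))
       \<bullet>\<^bsub>V\<^esub> pmap V (Id V (EHom C X Y)) (\<phi> r))"

definition coalg_g ::
  "('o, 'a) ccc \<Rightarrow> ('c, 'o, 'a) smvcat \<Rightarrow> ('o, 'a) operad_data \<Rightarrow>
   'c \<times> (nat \<Rightarrow> 'a) \<Rightarrow> 'c \<times> (nat \<Rightarrow> 'a) \<Rightarrow> nat \<Rightarrow> 'a" where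
  "coalg_g V C P x y r = (case (x, y) of ((X, \<phi>), (Y, \<psi>)) \<Rightarrow>
     EComp C X Y (tpow C Y r)
       \<bullet>\<^bsub>V\<^esub> swap V (EHom C X Y) (EHom C Y (tpow C Y r))
       \<bullet>\<^bsub>V\<^esub> pmap V (Id V (EHom C X Y)) (\<psi> r))"

text \<open>
  \<open>is_mapping_object V C P x y M e\<close>: the object \<open>M\<close> with \<open>e : M \<rightarrow> EHom C X Y\<close> is an equaliser of
  the two maps into (some choice of) the product of the internal homs
  \<open>IHom V (P r) (EHom C X (Y\<^sup>r))\<close>.
\<close>

definition is_mapping_object ::
  "('o, 'a) ccc \<Rightarrow> ('c, 'o, 'a) smvcat \<Rightarrow> ('o, 'a) operad_data \<Rightarrow>
   'c \<times> (nat \<Rightarrow> 'a) \<Rightarrow> 'c \<times> (nat \<Rightarrow> 'a) \<Rightarrow> 'o \<Rightarrow> 'a \<Rightarrow> bool" where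
  "is_mapping_object V C P x y M e \<longleftrightarrow>
     (let H = EHom C (fst x) (fst y); K = (\<lambda>r. EHom C (fst x) (tpow C (fst y) r)) in
      \<exists>L p f g.
        is_product V (relevant_degrees V P) (\<lambda>r. IHom V (OpObj P r) (K r)) L p \<and>
        f \<in> Hom V H L \<and> g \<in> Hom V H L \<and>
        (\<forall>r\<in>relevant_degrees V P. p r \<bullet>\<^bsub>V\<^esub> f = curry V H (OpObj P r) (K r) (coalg_f V C P x y r) \<and>
                          p r \<bullet>\<^bsub>V\<^esub> g = curry V H (OpObj P r) (K r) (coalg_g V C P x y r)) \<and>
        is_equaliser V f g M e)"

text \<open>
  Coalgebras with given mapping objects \<open>M x y\<close> and inclusions \<open>e x y : M x y \<rightarrow> EHom C X Y\<close>;
  composition and identities are the unique ones compatible with those of \<open>C\<close>.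
\<close>

definition coalg_vcat ::
  "('o, 'a) ccc \<Rightarrow> ('c, 'o, 'a) smvcat \<Rightarrow> ('o, 'a) operad_data \<Rightarrow>
   ('c \<times> (nat \<Rightarrow> 'a) \<Rightarrow> 'c \<times> (nat \<Rightarrow> 'a) \<Rightarrow> 'o) \<Rightarrow>
   ('c \<times> (nat \<Rightarrow> 'a) \<Rightarrow> 'c \<times> (nat \<Rightarrow> 'a) \<Rightarrow> 'a) \<Rightarrow>
   ('c \<times> (nat \<Rightarrow> 'a), 'o, 'a) vcat" where
  "coalg_vcat V C P M e = \<lparr>
     EObj = coalgebras V C P,
     EHom = M,
     EComp = (\<lambda>x y z. THE m. m \<in> Hom V (Prod V (M y z) (M x y)) (M x z) \<and>
        e x z \<bullet>\<^bsub>V\<^esub> m = EComp C (fst x) (fst y) (fst z) \<bullet>\<^bsub>V\<^esub> pmap V (e y z) (e x y)),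
     EId = (\<lambda>x. THE i. i \<in> Hom V (One V) (M x x) \<and> e x x \<bullet>\<^bsub>V\<^esub> i = EId C (fst x))\<rparr>"

end

theory Submission
  imports Defs
begin

text \<open>
  Everything is computed with generalised elements.  For \<open>v : D \<rightarrow> \<C>(X, Y)\<close> and \<open>u : D \<rightarrow> \<C>(Y, Z)\<close>
  write \<open>u \<star> v : D \<rightarrow> \<C>(X, Z)\<close> for the composite and \<open>T\<^sub>r v : D \<rightarrow> \<C>(X\<^sup>r, Y\<^sup>r)\<close> for the \<open>r\<close>-th tensor
  power.  By the universal property of the internal hom, \<open>v\<close> factors through the mapping object
  of \<open>(X, \<phi>)\<close> and \<open>(Y, \<psi>)\<close> iff \<open>T\<^sub>r v \<star> \<phi> p = \<psi> p \<star> v\<close> for all \<open>p\<close> in \<open>\<P>(r)\<close>, at every stage over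
  \<open>D\<close>.  As \<open>\<otimes>\<close> is a \<open>\<V>\<close>-functor, \<open>T\<^sub>r\<close> preserves \<open>\<star>\<close> and identities, hence
  \<open>T\<^sub>r (u \<star> v) \<star> \<phi> p = T\<^sub>r u \<star> \<psi> p \<star> v = \<chi> p \<star> u \<star> v\<close>, so that composition and identities restrict.  The
  axioms of a \<open>\<V>\<close>-category are inherited because the inclusions are monic.
\<close>

section \<open>Cartesian closed categories\<close>

context category
begin

lemma Hom_Dom: "f \<in> Hom V A B \<Longrightarrow> Dom V f = A"
  and Hom_Cod: "f \<in> Hom V A B \<Longrightarrow> Cod V f = B"
  by (simp_all add: Hom_def)

lemma Hom_obj: "f \<in> Hom V A B \<Longrightarrow> A \<in> Obj V \<and> B \<in> Obj V"
  using dom_cod by (auto simp: Hom_def)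

end

context cartesian_closed_category
begin

section \<open>Terminal object, pairing and the structural maps of binary products\<close>

lemma one_obj: "One V \<in> Obj V"
  using one_terminal by (simp add: is_terminal_def)

lemma bang_hom: "A \<in> Obj V \<Longrightarrow> bang V A \<in> Hom V A (One V)"
  unfolding bang_def by (rule theI') (use one_terminal in \<open>simp add: is_terminal_def\<close>)

lemma to_one_unique:
  assumes "f \<in> Hom V A (One V)" and "g \<in> Hom V A (One V)"
  shows "f = g"
  using assms one_terminal Hom_obj[OF assms(1)] unfolding is_terminal_def by blast

lemma bang_comp:
  assumes "f \<in> Hom V A B"
  shows "bang V B \<bullet> f = bang V A"
  using to_one_unique[OF comp_hom[OF assms bang_hom] bang_hom] Hom_obj[OF assms] by blast

lemma pair_props:
  assumes "f \<in> Hom V D A" and "g \<in> Hom V D B"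
  shows "pair V f g \<in> Hom V D (Prod V A B) \<and>
    Pr1 V A B \<bullet> pair V f g = f \<and> Pr2 V A B \<bullet> pair V f g = g"
  unfolding pair_def Hom_Dom[OF assms(1)] Hom_Cod[OF assms(1)] Hom_Cod[OF assms(2)]
  by (rule theI', rule prod_universal[OF assms])

lemma pair_hom: "\<lbrakk>f \<in> Hom V D A; g \<in> Hom V D B\<rbrakk> \<Longrightarrow> pair V f g \<in> Hom V D (Prod V A B)"
  and pr1_pair: "\<lbrakk>f \<in> Hom V D A; g \<in> Hom V D B\<rbrakk> \<Longrightarrow> Pr1 V A B \<bullet> pair V f g = f"
  and pr2_pair: "\<lbrakk>f \<in> Hom V D A; g \<in> Hom V D B\<rbrakk> \<Longrightarrow> Pr2 V A B \<bullet> pair V f g = g"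
  using pair_props by blast+

lemma pair_eta:
  assumes "h \<in> Hom V D (Prod V A B)" and "A \<in> Obj V" and "B \<in> Obj V"
  shows "pair V (Pr1 V A B \<bullet> h) (Pr2 V A B \<bullet> h) = h"
proof -
  have "Pr1 V A B \<bullet> h \<in> Hom V D A" "Pr2 V A B \<bullet> h \<in> Hom V D B"
    using assms by (auto intro: comp_hom pr1_hom pr2_hom)
  from prod_universal[OF this] pair_props[OF this] assms(1) show ?thesis
    by blast
qed

lemma pair_pr:
  assumes "A \<in> Obj V" and "B \<in> Obj V"
  shows "pair V (Pr1 V A B) (Pr2 V A B) = Id V (Prod V A B)"
  using pair_eta[OF id_hom[OF prod_obj[OF assms]] assms]
  by (simp add: id_right[OF pr1_hom[OF assms]] id_right[OF pr2_hom[OF assms]])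

text \<open>Generalised elements suffice to compare maps out of a product: the two projections are
  such elements, and their pairing is the identity by \<open>pair_pr\<close>.\<close>

lemma prod_ext:
  assumes "f \<in> Hom V (Prod V A B) E" and "g \<in> Hom V (Prod V A B) E"
    and "A \<in> Obj V" and "B \<in> Obj V"
    and "\<And>K a b. \<lbrakk>a \<in> Hom V K A; b \<in> Hom V K B\<rbrakk> \<Longrightarrow> f \<bullet> pair V a b = g \<bullet> pair V a b"
  shows "f = g"
  using assms(5)[OF pr1_hom[OF assms(3,4)] pr2_hom[OF assms(3,4)]]
  by (simp add: pair_pr[OF assms(3,4)] id_right[OF assms(1)] id_right[OF assms(2)])

lemma pair_comp:
  assumes "f \<in> Hom V D A" and "g \<in> Hom V D B" and "h \<in> Hom V E D"
  shows "pair V f g \<bullet> h = pair V (f \<bullet> h) (g \<bullet> h)"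
proof -
  have obj: "A \<in> Obj V" "B \<in> Obj V"
    using assms Hom_obj by blast+
  have "pair V f g \<bullet> h = pair V (Pr1 V A B \<bullet> pair V f g \<bullet> h) (Pr2 V A B \<bullet> pair V f g \<bullet> h)"
    by (rule pair_eta[OF comp_hom[OF assms(3) pair_hom[OF assms(1,2)]] obj, symmetric])
  also have "\<dots> = pair V ((Pr1 V A B \<bullet> pair V f g) \<bullet> h) ((Pr2 V A B \<bullet> pair V f g) \<bullet> h)"
    by (simp only: comp_assoc[OF assms(3) pair_hom[OF assms(1,2)] pr1_hom[OF obj]]
        comp_assoc[OF assms(3) pair_hom[OF assms(1,2)] pr2_hom[OF obj]])
  finally show ?thesis
    using pr1_pair[OF assms(1,2)] pr2_pair[OF assms(1,2)] by simp
qed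

lemma pmap_hom:
  assumes "f \<in> Hom V A A'" and "g \<in> Hom V B B'"
  shows "pmap V f g \<in> Hom V (Prod V A B) (Prod V A' B')"
  using assms Hom_obj[OF assms(1)] Hom_obj[OF assms(2)]
  unfolding pmap_def Hom_Dom[OF assms(1)] Hom_Dom[OF assms(2)]
  by (auto intro: pair_hom comp_hom pr1_hom pr2_hom)

lemma pmap_pair:
  assumes "f \<in> Hom V A A'" and "g \<in> Hom V B B'" and "a \<in> Hom V D A" and "b \<in> Hom V D B"
  shows "pmap V f g \<bullet> pair V a b = pair V (f \<bullet> a) (g \<bullet> b)"
proof -
  have "A \<in> Obj V" "B \<in> Obj V"
    using assms Hom_obj by blast+
  note pr = pr1_hom[OF this] pr2_hom[OF this]
  show ?thesis
    unfolding pmap_def Hom_Dom[OF assms(1)] Hom_Dom[OF assms(2)]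
    using pair_comp[OF comp_hom[OF pr(1) assms(1)] comp_hom[OF pr(2) assms(2)] pair_hom[OF assms(3,4)]]
      comp_assoc[OF pair_hom[OF assms(3,4)] pr(1) assms(1)]
      comp_assoc[OF pair_hom[OF assms(3,4)] pr(2) assms(2)]
    by (simp add: pr1_pair[OF assms(3,4)] pr2_pair[OF assms(3,4)])
qed

lemma swap_hom: "\<lbrakk>A \<in> Obj V; B \<in> Obj V\<rbrakk> \<Longrightarrow> swap V A B \<in> Hom V (Prod V A B) (Prod V B A)"
  unfolding swap_def by (intro pair_hom pr1_hom pr2_hom)

lemma swap_pair:
  assumes "a \<in> Hom V D A" and "b \<in> Hom V D B"
  shows "swap V A B \<bullet> pair V a b = pair V b a"
proof -
  have "A \<in> Obj V" "B \<in> Obj V"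
    using assms Hom_obj by blast+
  then show ?thesis
    unfolding swap_def using assms pair_comp[OF pr2_hom pr1_hom pair_hom[OF assms]]
    by (simp add: pr1_pair pr2_pair)
qed

lemma assoc_hom:
  assumes "A \<in> Obj V" and "B \<in> Obj V" and "D \<in> Obj V"
  shows "assoc V A B D \<in> Hom V (Prod V (Prod V A B) D) (Prod V A (Prod V B D))"
proof -
  note pr = pr1_hom[OF prod_obj[OF assms(1,2)] assms(3)] pr2_hom[OF prod_obj[OF assms(1,2)] assms(3)]
  show ?thesis
    unfolding assoc_def
    by (intro pair_hom comp_hom[OF pr(1)] pr(2) pr1_hom pr2_hom assms)
qed

lemma assoc_pair:
  assumes "a \<in> Hom V E A" and "b \<in> Hom V E B" and "d \<in> Hom V E D"
  shows "assoc V A B D \<bullet> pair V (pair V a b) d = pair V a (pair V b d)"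
proof -
  have obj: "A \<in> Obj V" "B \<in> Obj V" "D \<in> Obj V"
    using assms Hom_obj by blast+
  let ?p = "Pr1 V (Prod V A B) D" and ?q = "Pr2 V (Prod V A B) D" and ?h = "pair V (pair V a b) d"
  have p: "?p \<in> Hom V (Prod V (Prod V A B) D) (Prod V A B)"
    and q: "?q \<in> Hom V (Prod V (Prod V A B) D) D"
    and p1: "Pr1 V A B \<in> Hom V (Prod V A B) A" and p2: "Pr2 V A B \<in> Hom V (Prod V A B) B"
    using obj by (auto intro: pr1_hom pr2_hom prod_obj)
  have ab: "pair V a b \<in> Hom V E (Prod V A B)"
    by (rule pair_hom[OF assms(1,2)])
  have h: "?h \<in> Hom V E (Prod V (Prod V A B) D)"
    by (rule pair_hom[OF ab assms(3)])
  show ?thesis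
    unfolding assoc_def
    by (simp add: pair_comp[OF comp_hom[OF p p1] pair_hom[OF comp_hom[OF p p2] q] h]
        pair_comp[OF comp_hom[OF p p2] q h] comp_assoc[OF h p p1] comp_assoc[OF h p p2]
        pr1_pair[OF ab assms(3)] pr2_pair[OF ab assms(3)]
        pr1_pair[OF assms(1,2)] pr2_pair[OF assms(1,2)])
qed

section \<open>Exponential transposes\<close>

lemma curry_props:
  assumes "f \<in> Hom V (Prod V D A) B" and "D \<in> Obj V" and "A \<in> Obj V"
  shows "curry V D A B f \<in> Hom V D (IHom V A B) \<and>
    Ev V A B \<bullet> pmap V (curry V D A B f) (Id V A) = f"
  unfolding curry_def
  by (rule theI', rule ihom_universal) (use assms Hom_obj in auto)

text \<open>The transpose of \<open>curry V D A B f \<bullet> h\<close> is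
  \<open>f \<bullet> pmap V h (Id V A)\<close>, and transposition is injective. This trades the
  internal homs in the equaliser for plain maps out of a product.\<close>

lemma curry_comp_eq_iff:
  assumes f: "f \<in> Hom V (Prod V D A) B" and g: "g \<in> Hom V (Prod V D A) B"
    and A: "A \<in> Obj V" and h: "h \<in> Hom V E D"
  shows "curry V D A B f \<bullet> h = curry V D A B g \<bullet> h \<longleftrightarrow>
    f \<bullet> pmap V h (Id V A) = g \<bullet> pmap V h (Id V A)"
proof -
  have obj: "E \<in> Obj V" "D \<in> Obj V" "B \<in> Obj V"
    using f h Hom_obj by blast+
  have ev: "Ev V A B \<in> Hom V (Prod V (IHom V A B) A) B"
    by (rule ev_hom[OF A obj(3)])
  note i = id_hom[OF A]
  have uncurry: "Ev V A B \<bullet> pmap V (curry V D A B k \<bullet> h) (Id V A) = k \<bullet> pmap V h (Id V A)"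
    if k: "k \<in> Hom V (Prod V D A) B" for k
  proof -
    note c = curry_props[OF k obj(2) A]
    have c1: "curry V D A B k \<in> Hom V D (IHom V A B)"
      using c by blast
    have pr: "Pr1 V E A \<in> Hom V (Prod V E A) E" "Pr2 V E A \<in> Hom V (Prod V E A) A"
      by (rule pr1_hom[OF obj(1) A] pr2_hom[OF obj(1) A])+
    \<comment> \<open>Functoriality of the product with \<open>A\<close>: once
      \<open>pmap V h (Id V A)\<close> is expanded into a pair built from projections,
      \<open>pmap_pair\<close> applies.\<close>
    have "pmap V (curry V D A B k) (Id V A) \<bullet> pmap V h (Id V A)
        = pmap V (curry V D A B k \<bullet> h) (Id V A)"
      using pmap_pair[OF c1 i comp_hom[OF pr(1) h] comp_hom[OF pr(2) i]]
      unfolding pmap_def[of _ h] pmap_def[of _ "curry V D A B k \<bullet> h"]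
        Hom_Dom[OF comp_hom[OF h c1]] Hom_Dom[OF h] Hom_Dom[OF i]
      by (simp add: comp_assoc[OF pr(1) h c1] id_left[OF pr(2)])
    then show ?thesis
      using c comp_assoc[OF pmap_hom[OF h i] pmap_hom[OF c1 i] ev] by simp
  qed
  have hom: "curry V D A B k \<bullet> h \<in> Hom V E (IHom V A B)"
    if "k \<in> Hom V (Prod V D A) B" for k
    using curry_props[OF that obj(2) A] comp_hom[OF h] by blast
  \<comment> \<open>Uniqueness of the transpose of this arrow gives one direction; uncurrying both
    sides gives the other.\<close>
  have "f \<bullet> pmap V h (Id V A) \<in> Hom V (Prod V E A) B"
    by (rule comp_hom[OF pmap_hom[OF h i] f])
  from ihom_universal[OF obj(1) A obj(3) this] show ?thesis
    using uncurry[OF f] uncurry[OF g] hom[OF f] hom[OF g] by metis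
qed

section \<open>Tuples of equal arrows and the diagonal\<close>

lemma tuple_replicate_hom:
  "v \<in> Hom V D A \<Longrightarrow> tuple V D (replicate r v) \<in> Hom V D (Prods V (replicate r A))"
  by (induction r) (use Hom_obj in \<open>auto intro: bang_hom pair_hom\<close>)

lemma tuple_replicate_comp:
  assumes "v \<in> Hom V D A" and "h \<in> Hom V E D"
  shows "tuple V D (replicate r v) \<bullet> h = tuple V E (replicate r (v \<bullet> h))"
  by (induction r) (simp_all add: bang_comp[OF assms(2)]
      pair_comp[OF assms(1) tuple_replicate_hom[OF assms(1)] assms(2)])

lemma diag_comp: "v \<in> Hom V D A \<Longrightarrow> diag V r A \<bullet> v = tuple V D (replicate r v)"
  unfolding diag_def using Hom_obj
  by (subst tuple_replicate_comp[of _ A A]) (auto intro: id_hom simp: id_left)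

lemma diag_hom: "A \<in> Obj V \<Longrightarrow> diag V r A \<in> Hom V A (Prods V (replicate r A))"
  unfolding diag_def by (rule tuple_replicate_hom[OF id_hom])

end

section \<open>Generalised elements of enriched categories\<close>

context V_category
begin

text \<open>The composite \<open>u \<star> v\<close>. The stage \<open>D\<close> is not a parameter
  because \<open>pair\<close> reads it off the domain of \<open>u\<close>.\<close>

definition gcomp :: "'c \<Rightarrow> 'c \<Rightarrow> 'c \<Rightarrow> 'a \<Rightarrow> 'a \<Rightarrow> 'a" where
  "gcomp X Y Z u v = EComp C X Y Z \<bullet> pair V u v"

lemma gcomp_hom:
  assumes "X \<in> EObj C" and "Y \<in> EObj C" and "Z \<in> EObj C"
    and "u \<in> Hom V D (EHom C Y Z)" and "v \<in> Hom V D (EHom C X Y)"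
  shows "gcomp X Y Z u v \<in> Hom V D (EHom C X Z)"
  unfolding gcomp_def by (rule comp_hom[OF pair_hom[OF assms(4,5)] ecomp_hom[OF assms(1-3)]])

lemma gcomp_comp:
  assumes "X \<in> EObj C" and "Y \<in> EObj C" and "Z \<in> EObj C"
    and "u \<in> Hom V D (EHom C Y Z)" and "v \<in> Hom V D (EHom C X Y)" and "h \<in> Hom V E D"
  shows "gcomp X Y Z u v \<bullet> h = gcomp X Y Z (u \<bullet> h) (v \<bullet> h)"
  unfolding gcomp_def
  by (simp add: comp_assoc[OF assms(6) pair_hom[OF assms(4,5)] ecomp_hom[OF assms(1-3)]]
      pair_comp[OF assms(4-6)])

text \<open>The associativity axiom is evaluated at the element
  \<open>pair V (pair V u v) w\<close>, which \<open>assoc\<close> turns into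
  \<open>pair V u (pair V v w)\<close>.\<close>

lemma gcomp_assoc:
  assumes "W \<in> EObj C" and "X \<in> EObj C" and "Y \<in> EObj C" and "Z \<in> EObj C"
    and u: "u \<in> Hom V D (EHom C Y Z)" and v: "v \<in> Hom V D (EHom C X Y)"
    and w: "w \<in> Hom V D (EHom C W X)"
  shows "gcomp W X Z (gcomp X Y Z u v) w = gcomp W Y Z u (gcomp W X Y v w)"
proof -
  have obj: "EHom C Y Z \<in> Obj V" "EHom C X Y \<in> Obj V" "EHom C W X \<in> Obj V"
    using assms by (auto intro: ehom_obj)
  note c = ecomp_hom[OF assms(1,2,4)] ecomp_hom[OF assms(2-4)]
    ecomp_hom[OF assms(1,3,4)] ecomp_hom[OF assms(1-3)]
  note uv = pair_hom[OF u v] and vw = pair_hom[OF v w]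
  note l = pmap_hom[OF c(2) id_hom[OF obj(3)]] and r = pmap_hom[OF id_hom[OF obj(1)] c(4)]
  note a = assoc_hom[OF obj]
  let ?t = "pair V (pair V u v) w"
  have t: "?t \<in> Hom V D (Prod V (Prod V (EHom C Y Z) (EHom C X Y)) (EHom C W X))"
    by (rule pair_hom[OF uv w])
  have "gcomp W X Z (gcomp X Y Z u v) w =
      (EComp C W X Z \<bullet> pmap V (EComp C X Y Z) (Id V (EHom C W X))) \<bullet> ?t"
    unfolding gcomp_def
    by (simp add: comp_assoc[OF t l c(1)] pmap_pair[OF c(2) id_hom[OF obj(3)] uv w] id_left[OF w])
  also have "\<dots> = (EComp C W Y Z \<bullet> pmap V (Id V (EHom C Y Z)) (EComp C W X Y)
      \<bullet> assoc V (EHom C Y Z) (EHom C X Y) (EHom C W X)) \<bullet> ?t"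
    using ecomp_assoc[OF assms(1-4)] by simp
  also have "\<dots> = gcomp W Y Z u (gcomp W X Y v w)"
    unfolding gcomp_def
    by (simp add: comp_assoc[OF t comp_hom[OF a r] c(3)] comp_assoc[OF t a r] assoc_pair[OF u v w]
        pmap_pair[OF id_hom[OF obj(1)] c(4) u vw] id_left[OF u])
  finally show ?thesis .
qed

text \<open>The identity of \<open>X\<close> at stage \<open>D\<close> is the constant element that
  factors through the terminal object.\<close>

lemma gid_hom:
  "\<lbrakk>X \<in> EObj C; D \<in> Obj V\<rbrakk> \<Longrightarrow> EId C X \<bullet> bang V D \<in> Hom V D (EHom C X X)"
  by (rule comp_hom[OF bang_hom eid_hom])

text \<open>The axiom \<open>eid_left\<close> is evaluated at the element
  \<open>pair V (bang V D) v\<close>.\<close>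

lemma gcomp_left:
  assumes "X \<in> EObj C" and "Y \<in> EObj C" and v: "v \<in> Hom V D (EHom C X Y)"
  shows "gcomp X Y Y (EId C Y \<bullet> bang V D) v = v"
proof -
  have obj: "D \<in> Obj V" "EHom C X Y \<in> Obj V"
    using Hom_obj[OF v] by auto
  note b = bang_hom[OF obj(1)] and i = id_hom[OF obj(2)] and c = ecomp_hom[OF assms(1,2,2)]
    and j = eid_hom[OF assms(2)]
  have "gcomp X Y Y (EId C Y \<bullet> bang V D) v =
      (EComp C X Y Y \<bullet> pmap V (EId C Y) (Id V (EHom C X Y))) \<bullet> pair V (bang V D) v"
    unfolding gcomp_def
    by (simp add: comp_assoc[OF pair_hom[OF b v] pmap_hom[OF j i] c] pmap_pair[OF j i b v] id_left[OF v])
  then show ?thesis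
    by (simp add: eid_left[OF assms(1,2)] pr2_pair[OF b v])
qed

lemma gcomp_right:
  assumes "X \<in> EObj C" and "Y \<in> EObj C" and v: "v \<in> Hom V D (EHom C X Y)"
  shows "gcomp X X Y v (EId C X \<bullet> bang V D) = v"
proof -
  have obj: "D \<in> Obj V" "EHom C X Y \<in> Obj V"
    using Hom_obj[OF v] by auto
  note b = bang_hom[OF obj(1)] and i = id_hom[OF obj(2)] and c = ecomp_hom[OF assms(1,1,2)]
    and j = eid_hom[OF assms(1)]
  have "gcomp X X Y v (EId C X \<bullet> bang V D) =
      (EComp C X X Y \<bullet> pmap V (Id V (EHom C X Y)) (EId C X)) \<bullet> pair V v (bang V D)"
    unfolding gcomp_def
    by (simp add: comp_assoc[OF pair_hom[OF v b] pmap_hom[OF i j] c] pmap_pair[OF i j v b] id_left[OF v])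
  then show ?thesis
    by (simp add: eid_right[OF assms(1,2)] pr1_pair[OF v b])
qed

end

section \<open>The tensor product on generalised elements\<close>

context symmetric_monoidal_V_category
begin

lemma ten_obj: "\<lbrakk>A \<in> EObj C; B \<in> EObj C\<rbrakk> \<Longrightarrow> Ten C A B \<in> EObj C"
  using ten_functor by (auto simp: V_functor_def vcat_tensor_def)

lemma tenhom_hom:
  "\<lbrakk>A \<in> EObj C; B \<in> EObj C; A' \<in> EObj C; B' \<in> EObj C\<rbrakk> \<Longrightarrow>
    TenHom C A B A' B' \<in> Hom V (Prod V (EHom C A A') (EHom C B B')) (EHom C (Ten C A B) (Ten C A' B'))"
  using ten_functor by (auto simp: V_functor_def vcat_tensor_def)

lemma tenhom_id:
  "\<lbrakk>A \<in> EObj C; B \<in> EObj C\<rbrakk> \<Longrightarrow>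
    TenHom C A B A B \<bullet> pair V (EId C A) (EId C B) = EId C (Ten C A B)"
  using ten_functor by (auto simp: V_functor_def vcat_tensor_def)

lemma tenhom_ecomp:
  assumes "A \<in> EObj C" "B \<in> EObj C" "A' \<in> EObj C" "B' \<in> EObj C" "A'' \<in> EObj C" "B'' \<in> EObj C"
  shows "TenHom C A B A'' B'' \<bullet> pair V
      (EComp C A A' A'' \<bullet>
        pmap V (Pr1 V (EHom C A' A'') (EHom C B' B'')) (Pr1 V (EHom C A A') (EHom C B B')))
      (EComp C B B' B'' \<bullet>
        pmap V (Pr2 V (EHom C A' A'') (EHom C B' B'')) (Pr2 V (EHom C A A') (EHom C B B'))) =
    EComp C (Ten C A B) (Ten C A' B') (Ten C A'' B'') \<bullet>
      pmap V (TenHom C A' B' A'' B'') (TenHom C A B A' B')"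
proof -
  \<comment> \<open>The composition clause is first stated over arbitrary pairs, in the shape it has
    in \<open>V_functor\<close>; at explicit pairs the case abstractions then reduce.\<close>
  have "\<forall>X\<in>EObj C \<times> EObj C. \<forall>Y\<in>EObj C \<times> EObj C. \<forall>Z\<in>EObj C \<times> EObj C.
     (\<lambda>(A, B) (A', B'). TenHom C A B A' B') X Z \<bullet> EComp (vcat_tensor V C C) X Y Z =
     EComp C ((\<lambda>(A, B). Ten C A B) X) ((\<lambda>(A, B). Ten C A B) Y) ((\<lambda>(A, B). Ten C A B) Z) \<bullet>
     pmap V ((\<lambda>(A, B) (A', B'). TenHom C A B A' B') Y Z) ((\<lambda>(A, B) (A', B'). TenHom C A B A' B') X Y)"
    using ten_functor unfolding V_functor_def by (simp add: vcat_tensor_def)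
  from this[rule_format, of "(A, B)" "(A', B')" "(A'', B'')"] assms show ?thesis
    by (simp add: vcat_tensor_def)
qed

definition gten :: "'c \<Rightarrow> 'c \<Rightarrow> 'c \<Rightarrow> 'c \<Rightarrow> 'a \<Rightarrow> 'a \<Rightarrow> 'a" where
  "gten A B A' B' a b = TenHom C A B A' B' \<bullet> pair V a b"

lemma gten_id:
  assumes "A \<in> EObj C" "B \<in> EObj C" "D \<in> Obj V"
  shows "gten A B A B (EId C A \<bullet> bang V D) (EId C B \<bullet> bang V D) = EId C (Ten C A B) \<bullet> bang V D"
proof -
  note j = eid_hom[OF assms(1)] eid_hom[OF assms(2)] and b = bang_hom[OF assms(3)]
  show ?thesis
    unfolding gten_def tenhom_id[OF assms(1,2), symmetric]
    by (simp add: comp_assoc[OF b pair_hom[OF j] tenhom_hom[OF assms(1,2,1,2)]] pair_comp[OF j b])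
qed

text \<open>The interchange law. Composition in the tensor square of \<open>C\<close> regroups first
  components with first and second with second, so evaluating \<open>tenhom_ecomp\<close> at the
  element \<open>((a', b'), (a, b))\<close> produces both sides.\<close>

lemma gten_gcomp:
  assumes obj: "A \<in> EObj C" "B \<in> EObj C" "A' \<in> EObj C" "B' \<in> EObj C" "A'' \<in> EObj C" "B'' \<in> EObj C"
    and a: "a \<in> Hom V D (EHom C A A')" and b: "b \<in> Hom V D (EHom C B B')"
    and a': "a' \<in> Hom V D (EHom C A' A'')" and b': "b' \<in> Hom V D (EHom C B' B'')"
  shows "gten A B A'' B'' (gcomp A A' A'' a' a) (gcomp B B' B'' b' b) =
    gcomp (Ten C A B) (Ten C A' B') (Ten C A'' B'') (gten A' B' A'' B'' a' b') (gten A B A' B' a b)"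
proof -
  note o1 = ehom_obj[OF obj(3,5)] ehom_obj[OF obj(4,6)] and o2 = ehom_obj[OF obj(1,3)] ehom_obj[OF obj(2,4)]
  note P1 = pr1_hom[OF o1] pr1_hom[OF o2] and P2 = pr2_hom[OF o1] pr2_hom[OF o2]
  note c1 = ecomp_hom[OF obj(1,3,5)] and c2 = ecomp_hom[OF obj(2,4,6)]
    and t = tenhom_hom[OF obj(1,2,5,6)]
  note t1 = tenhom_hom[OF obj(3-6)] and t2 = tenhom_hom[OF obj(1-4)]
    and c = ecomp_hom[OF ten_obj[OF obj(1,2)] ten_obj[OF obj(3,4)] ten_obj[OF obj(5,6)]]
  note ab = pair_hom[OF a b] and ab' = pair_hom[OF a' b']
  note p1 = pmap_hom[OF P1] and p2 = pmap_hom[OF P2]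
  note s1 = comp_hom[OF p1 c1] and s2 = comp_hom[OF p2 c2]
  let ?p = "pair V (pair V a' b') (pair V a b)"
  note p = pair_hom[OF ab' ab]
  have "gten A B A'' B'' (gcomp A A' A'' a' a) (gcomp B B' B'' b' b) =
      (TenHom C A B A'' B'' \<bullet> pair V
        (EComp C A A' A'' \<bullet>
          pmap V (Pr1 V (EHom C A' A'') (EHom C B' B'')) (Pr1 V (EHom C A A') (EHom C B B')))
        (EComp C B B' B'' \<bullet>
          pmap V (Pr2 V (EHom C A' A'') (EHom C B' B'')) (Pr2 V (EHom C A A') (EHom C B B')))) \<bullet> ?p"
    unfolding gten_def gcomp_def
    by (simp add: comp_assoc[OF p pair_hom[OF s1 s2] t] pair_comp[OF s1 s2 p]
        comp_assoc[OF p p1 c1] comp_assoc[OF p p2 c2] pmap_pair[OF P1 ab' ab] pmap_pair[OF P2 ab' ab]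
        pr1_pair[OF a b] pr1_pair[OF a' b'] pr2_pair[OF a b] pr2_pair[OF a' b'])
  also have "\<dots> = (EComp C (Ten C A B) (Ten C A' B') (Ten C A'' B'') \<bullet>
      pmap V (TenHom C A' B' A'' B'') (TenHom C A B A' B')) \<bullet> ?p"
    by (simp only: tenhom_ecomp[OF obj])
  also have "\<dots> = gcomp (Ten C A B) (Ten C A' B') (Ten C A'' B'')
      (gten A' B' A'' B'' a' b') (gten A B A' B' a b)"
    unfolding gten_def gcomp_def
    by (simp add: comp_assoc[OF p pmap_hom[OF t1 t2] c] pmap_pair[OF t1 t2 ab' ab])
  finally show ?thesis .
qed

section \<open>Tensor powers of generalised elements\<close>

lemma tpow_simps:
  "tpow C X 0 = Unit C" "tpow C X (Suc 0) = X"
  "tpow C X (Suc (Suc n)) = Ten C X (tpow C X (Suc n))"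
  by (simp_all add: tpow_def)

text \<open>The first power is \<open>X\<close> itself rather than \<open>X\<close> tensored with
  the unit, so this and the following inductions on \<open>r\<close> have both 0 and 1 as base
  cases.\<close>

lemma tpow_obj: "X \<in> EObj C \<Longrightarrow> tpow C X r \<in> EObj C"
  by (induction r rule: induct_nat_012) (simp_all add: tpow_simps unit_obj ten_obj)

lemma tens_hom_replicate_Suc_Suc:
  "tens_hom V C (replicate (Suc (Suc n)) (X, Y)) =
     TenHom C X (tpow C X (Suc n)) Y (tpow C Y (Suc n))
       \<bullet> pmap V (Id V (EHom C X Y)) (tens_hom V C (replicate (Suc n) (X, Y)))"
  by (simp add: tpow_def)

lemma tens_hom_replicate_hom:
  assumes "X \<in> EObj C" and "Y \<in> EObj C"
  shows "tens_hom V C (replicate r (X, Y))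
    \<in> Hom V (Prods V (replicate r (EHom C X Y))) (EHom C (tpow C X r) (tpow C Y r))"
proof (induction r rule: induct_nat_012)
  case 0
  then show ?case
    by (simp add: tpow_simps eid_hom unit_obj)
next
  case 1
  then show ?case
    by (simp add: tpow_simps pr1_hom ehom_obj assms one_obj)
next
  case (ge2 n)
  note ih = pmap_hom[OF id_hom[OF ehom_obj[OF assms]] ge2(2)]
  show ?case
    unfolding tens_hom_replicate_Suc_Suc tpow_simps
    using comp_hom[OF ih tenhom_hom[OF assms(1) tpow_obj[OF assms(1)] assms(2) tpow_obj[OF assms(2)]]]
    by simp
qed

text \<open>The tensor power \<open>T\<^sub>r v\<close> of the overview. Diagonal and tensor map are
  kept as separate factors, matching the shape of \<open>coalg_f\<close>.\<close>

definition gpow :: "'c \<Rightarrow> 'c \<Rightarrow> nat \<Rightarrow> 'a \<Rightarrow> 'a" where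
  "gpow X Y r v = tens_hom V C (replicate r (X, Y)) \<bullet> diag V r (EHom C X Y) \<bullet> v"

lemma gpow_hom:
  assumes "X \<in> EObj C" and "Y \<in> EObj C" and "v \<in> Hom V D (EHom C X Y)"
  shows "gpow X Y r v \<in> Hom V D (EHom C (tpow C X r) (tpow C Y r))"
  unfolding gpow_def
  by (rule comp_hom[OF comp_hom[OF assms(3) diag_hom[OF ehom_obj[OF assms(1,2)]]]
        tens_hom_replicate_hom[OF assms(1,2)]])

lemma gpow_0:
  assumes "v \<in> Hom V D (EHom C X Y)"
  shows "gpow X Y 0 v = EId C (Unit C) \<bullet> bang V D"
  unfolding gpow_def by (simp add: diag_comp[OF assms])

lemma gpow_1:
  assumes "v \<in> Hom V D (EHom C X Y)"
  shows "gpow X Y (Suc 0) v = v"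
  unfolding gpow_def using Hom_obj[OF assms]
  by (simp add: diag_comp[OF assms] pr1_pair[OF assms bang_hom])

text \<open>By \<open>diag_comp\<close> the diagonal becomes a tuple of copies of \<open>v\<close>;
  its head feeds the left tensor factor and its tail is the next smaller power. This recursion lets
  the laws of \<open>gten\<close> be applied inductively.\<close>

lemma gpow_Suc_Suc:
  assumes "X \<in> EObj C" and "Y \<in> EObj C" and "v \<in> Hom V D (EHom C X Y)"
  shows "gpow X Y (Suc (Suc n)) v =
    gten X (tpow C X (Suc n)) Y (tpow C Y (Suc n)) v (gpow X Y (Suc n) v)"
proof -
  note i = id_hom[OF ehom_obj[OF assms(1,2)]]
  note t = tens_hom_replicate_hom[OF assms(1,2), of "Suc n"]
  note p = tuple_replicate_hom[OF assms(3), of "Suc n"]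
  show ?thesis
    unfolding gpow_def gten_def diag_comp[OF assms(3)] tens_hom_replicate_Suc_Suc
      replicate_Suc[of "Suc n" v] tuple.simps(2)[of _ _ v "replicate (Suc n) v"]
    by (simp only: comp_assoc[OF pair_hom[OF assms(3) p] pmap_hom[OF i t]
          tenhom_hom[OF assms(1) tpow_obj[OF assms(1)] assms(2) tpow_obj[OF assms(2)]]]
        pmap_pair[OF i t assms(3) p] id_left[OF assms(3)])
qed

lemma gpow_id:
  assumes "X \<in> EObj C" and "D \<in> Obj V"
  shows "gpow X X r (EId C X \<bullet> bang V D) = EId C (tpow C X r) \<bullet> bang V D"
proof (induction r rule: induct_nat_012)
  case (ge2 n)
  then show ?case
    by (simp add: gpow_Suc_Suc[OF assms(1,1) gid_hom[OF assms]] tpow_simps(3)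
        gten_id[OF assms(1) tpow_obj[OF assms(1)] assms(2)])
qed (simp_all add: gpow_0[OF gid_hom[OF assms]] gpow_1[OF gid_hom[OF assms]] tpow_simps)

text \<open>Each inductive step is one use of the interchange law \<open>gten_gcomp\<close>.\<close>

lemma gpow_gcomp:
  assumes X: "X \<in> EObj C" and Y: "Y \<in> EObj C" and Z: "Z \<in> EObj C"
    and u: "u \<in> Hom V D (EHom C Y Z)" and v: "v \<in> Hom V D (EHom C X Y)"
  shows "gpow X Z r (gcomp X Y Z u v) =
    gcomp (tpow C X r) (tpow C Y r) (tpow C Z r) (gpow Y Z r u) (gpow X Y r v)"
proof (induction r rule: induct_nat_012)
  case 0
  have "D \<in> Obj V"
    using Hom_obj[OF u] by blast
  \<comment> \<open>Every zeroth power is the identity of the unit object at stage \<open>D\<close>,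
    so the claim is that this identity composed with itself is itself.\<close>
  then show ?case
    using gcomp_left[OF unit_obj unit_obj gid_hom[OF unit_obj]]
    by (simp add: gpow_0[OF gcomp_hom[OF X Y Z u v]] gpow_0[OF u] gpow_0[OF v] tpow_simps)
next
  case 1
  show ?case
    by (simp add: gpow_1[OF gcomp_hom[OF X Y Z u v]] gpow_1[OF u] gpow_1[OF v] tpow_simps)
next
  case (ge2 n)
  then show ?case
    by (simp add: gpow_Suc_Suc[OF X Z gcomp_hom[OF X Y Z u v]] gpow_Suc_Suc[OF Y Z u]
        gpow_Suc_Suc[OF X Y v] tpow_simps(3)
        gten_gcomp[OF X tpow_obj[OF X] Y tpow_obj[OF Y] Z tpow_obj[OF Z]
          v gpow_hom[OF X Y v] u gpow_hom[OF Y Z u]])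
qed

end

section \<open>Products and equalisers from completeness\<close>

text \<open>A product is a limit over a discrete diagram, and any set of natural numbers can be
  copied into the infinite universe \<open>'u\<close> by an injection.\<close>

lemma (in category) complete_imp_countable_product:
  fixes F :: "nat \<Rightarrow> 'o"
  assumes "infinite (UNIV :: 'u set)" and "complete_category TYPE('u) V"
    and F: "\<And>i. i \<in> I \<Longrightarrow> F i \<in> Obj V"
  obtains L p where "is_product V I F L p"
proof -
  obtain n :: "nat \<Rightarrow> 'u" where n: "inj n"
    using assms(1) infinite_countable_subset by blast
  define J :: "('u, 'u) cat" where
    "J = \<lparr>Obj = n ` I, Arr = n ` I, Dom = id, Cod = id, Id = id, Comp = (\<lambda>g f. f)\<rparr>"
  define F0 where "F0 = F \<circ> inv n"
  have "category J"
    by unfold_locales (auto simp: J_def Hom_def)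
  moreover have "is_functor J V F0 (Id V \<circ> F0)"
    using F by (auto simp: is_functor_def J_def F0_def n id_hom id_left[OF id_hom])
  ultimately obtain L p where lim: "is_limit J V F0 (Id V \<circ> F0) L p"
    using assms(2) unfolding complete_category_def by blast
  \<comment> \<open>All arrows of the diagram are identities, so naturality of a cone is automatic
    and only the family of legs remains.\<close>
  have cone: "is_cone J V F0 (Id V \<circ> F0) K q \<longleftrightarrow>
      K \<in> Obj V \<and> (\<forall>i\<in>I. (q \<circ> n) i \<in> Hom V K (F i))" for K q
    using n id_left by (auto simp: is_cone_def J_def F0_def)
  have "is_product V I F L (p \<circ> n)"
    unfolding is_product_def
  proof (intro conjI ballI allI impI)
    show "(p \<circ> n) i \<in> Hom V L (F i)" if "i \<in> I" for i
      using lim that unfolding is_limit_def cone by blast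
    show "L \<in> Obj V"
      using lim unfolding is_limit_def cone by blast
    fix K q
    assume "K \<in> Obj V" and "\<forall>i\<in>I. q i \<in> Hom V K (F i)"
    then have "is_cone J V F0 (Id V \<circ> F0) K (q \<circ> inv n)"
      unfolding cone by (simp add: n)
    with lim have "\<exists>!h. h \<in> Hom V K L \<and> (\<forall>i\<in>Obj J. p i \<bullet> h = (q \<circ> inv n) i)"
      unfolding is_limit_def by blast
    then show "\<exists>!h. h \<in> Hom V K L \<and> (\<forall>i\<in>I. (p \<circ> n) i \<bullet> h = q i)"
      by (simp add: J_def n)
  qed
  then show thesis
    by (rule that)
qed

text \<open>An equaliser is a limit over the parallel pair category, which has four arrows and
  therefore fits into \<open>'u\<close>.\<close>

lemma (in category) complete_imp_equaliser:
  assumes "infinite (UNIV :: 'u set)" and "complete_category TYPE('u) V"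
    and f: "f \<in> Hom V A B" and g: "g \<in> Hom V A B"
  obtains E e where "is_equaliser V f g E e"
proof -
  obtain n :: "nat \<Rightarrow> 'u" where n: "inj n"
    using assms(1) infinite_countable_subset by blast
  \<comment> \<open>\<open>a\<close> and \<open>b\<close> are the two objects and also name their
    identities; \<open>s\<close> and \<open>t\<close> are the parallel arrows from \<open>a\<close>
    to \<open>b\<close>, to be sent to \<open>f\<close> and \<open>g\<close>.\<close>
  define a b s t where "a = n 0" and "b = n 1" and "s = n 2" and "t = n 3"
  have distinct: "a \<noteq> b" "a \<noteq> s" "a \<noteq> t" "b \<noteq> s" "b \<noteq> t" "s \<noteq> t"
    unfolding a_def b_def s_def t_def by (simp_all add: inj_eq[OF n])
  define J :: "('u, 'u) cat" where
    "J = \<lparr>Obj = {a, b}, Arr = {a, b, s, t}, Dom = (\<lambda>k. if k = b then b else a),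
      Cod = (\<lambda>k. if k = a then a else b), Id = id,
      Comp = (\<lambda>l k. if k = a \<or> k = b then l else k)\<rparr>"
  define F0 where "F0 k = (if k = a then A else B)" for k
  define F1 where "F1 k = (if k = a then Id V A else if k = b then Id V B else if k = s then f else g)" for k
  have obj: "A \<in> Obj V" "B \<in> Obj V"
    using Hom_obj[OF f] by auto
  note ids = id_hom[OF obj(1)] id_hom[OF obj(2)]
  have "category J"
    by unfold_locales (use distinct in \<open>auto simp: J_def Hom_def split: if_splits\<close>)
  moreover have "is_functor J V F0 F1"
    using distinct f g obj ids
    by (auto simp: is_functor_def J_def F0_def F1_def id_left[OF ids(1)] id_left[OF ids(2)]
        id_left[OF f] id_left[OF g] id_right[OF f] id_right[OF g])
  ultimately obtain L p where lim: "is_limit J V F0 F1 L p"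
    using assms(2) unfolding complete_category_def by blast
  \<comment> \<open>A cone is determined by its leg at \<open>a\<close>: the arrow \<open>s\<close>
    forces the leg at \<open>b\<close> to be \<open>f \<bullet> q a\<close>, and \<open>t\<close>
    then forces the equalising equation.\<close>
  have cone: "is_cone J V F0 F1 K q \<longleftrightarrow>
      q a \<in> Hom V K A \<and> q b = f \<bullet> q a \<and> f \<bullet> q a = g \<bullet> q a" for K q
    using distinct Hom_obj[of "q a" K A] comp_hom[OF _ f, of "q a" K]
    by (auto simp: is_cone_def J_def F0_def F1_def id_left)
  have e: "p a \<in> Hom V L A" "p b = f \<bullet> p a" "f \<bullet> p a = g \<bullet> p a"
    using lim unfolding is_limit_def cone by auto
  have "is_equaliser V f g L (p a)"
    unfolding is_equaliser_def Hom_Dom[OF f]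
  proof (intro conjI allI ballI impI e)
    fix K k
    assume k: "k \<in> Hom V K A" and eq: "f \<bullet> k = g \<bullet> k"
    let ?q = "\<lambda>i. if i = a then k else f \<bullet> k"
    have "is_cone J V F0 F1 K ?q"
      unfolding cone using distinct k eq by auto
    with lim have "\<exists>!h. h \<in> Hom V K L \<and> (\<forall>i\<in>Obj J. p i \<bullet> h = ?q i)"
      unfolding is_limit_def by blast
    moreover have "(\<forall>i\<in>Obj J. p i \<bullet> h = ?q i) \<longleftrightarrow> p a \<bullet> h = k" if "h \<in> Hom V K L" for h
      using distinct e(2) comp_assoc[OF that e(1) f] by (auto simp: J_def)
    ultimately show "\<exists>!h. h \<in> Hom V K L \<and> p a \<bullet> h = k"
      by metis
  qed
  then show thesis
    by (rule that)
qed

lemma is_product_lift: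
  assumes "is_product V I F L p" and "K \<in> Obj V" and "\<And>i. i \<in> I \<Longrightarrow> q i \<in> Hom V K (F i)"
  shows "\<exists>!h. h \<in> Hom V K L \<and> (\<forall>i\<in>I. p i \<bullet>\<^bsub>V\<^esub> h = q i)"
  using assms unfolding is_product_def by blast

section \<open>Coalgebras\<close>

locale operad_coalgebras = symmetric_monoidal_V_category V C + operad V P
  for V :: "('o, 'a) ccc" (structure) and C :: "('c, 'o, 'a) smvcat" and P :: "('o, 'a) operad_data"
begin

abbreviation R :: "nat set" where
  "R \<equiv> relevant_degrees V P"

lemma coalgebra_obj: "x \<in> coalgebras V C P \<Longrightarrow> fst x \<in> EObj C"
  by (auto simp: coalgebras_def)

lemma coalgebra_structure_hom:
  "\<lbrakk>x \<in> coalgebras V C P; r \<in> R\<rbrakk> \<Longrightarrow> snd x r \<in> Hom V (OpObj P r) (EHom C (fst x) (tpow C (fst x) r))"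
  by (auto simp: coalgebras_def operad_morphism_def CoEnd_def)

text \<open>
  The condition is imposed at every stage \<open>h : K \<rightarrow> D\<close>, not just at \<open>D\<close>: it then includes the
  universal case \<open>K = D \<times> \<P>(r)\<close>, which is the equation between the adjoints.
\<close>

definition coalg_elem ::
  "'c \<times> (nat \<Rightarrow> 'a) \<Rightarrow> 'c \<times> (nat \<Rightarrow> 'a) \<Rightarrow> 'o \<Rightarrow> 'a \<Rightarrow> bool" where
  "coalg_elem x y D v \<longleftrightarrow> v \<in> Hom V D (EHom C (fst x) (fst y)) \<and>
    (\<forall>r\<in>R. \<forall>K h p. h \<in> Hom V K D \<longrightarrow> p \<in> Hom V K (OpObj P r) \<longrightarrow>
      gcomp (fst x) (tpow C (fst x) r) (tpow C (fst y) r) (gpow (fst x) (fst y) r (v \<bullet> h)) (snd x r \<bullet> p) =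
      gcomp (fst x) (fst y) (tpow C (fst y) r) (snd y r \<bullet> p) (v \<bullet> h))"

lemma coalg_elem_hom: "coalg_elem x y D v \<Longrightarrow> v \<in> Hom V D (EHom C (fst x) (fst y))"
  by (simp add: coalg_elem_def)

text \<open>The condition at the stage \<open>D\<close> itself, where \<open>h\<close> is the
  identity.\<close>

lemma coalg_elem_eq:
  assumes "coalg_elem x y D v" and "r \<in> R" and "p \<in> Hom V D (OpObj P r)"
  shows "gcomp (fst x) (tpow C (fst x) r) (tpow C (fst y) r) (gpow (fst x) (fst y) r v) (snd x r \<bullet> p) =
    gcomp (fst x) (fst y) (tpow C (fst y) r) (snd y r \<bullet> p) v"
  using assms id_hom[of D] Hom_obj[OF assms(3)] unfolding coalg_elem_def by (metis id_right)

text \<open>The defining condition ranges over all stages over \<open>D\<close>, and every stage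
  over \<open>E\<close> is one over \<open>D\<close> by composing with \<open>h\<close>.\<close>

lemma coalg_elem_comp:
  assumes "coalg_elem x y D v" and h: "h \<in> Hom V E D"
  shows "coalg_elem x y E (v \<bullet> h)"
proof -
  note v = coalg_elem_hom[OF assms(1)]
  have "(v \<bullet> h) \<bullet> k = v \<bullet> h \<bullet> k" if "k \<in> Hom V K E" for K k
    by (rule comp_assoc[OF that h v])
  then show ?thesis
    using assms(1) comp_hom[OF h v] comp_hom[OF _ h] unfolding coalg_elem_def by simp blast
qed

text \<open>Tensor powers of an identity are identities, so by the unit laws both sides reduce to
  \<open>snd x r \<bullet> p\<close>.\<close>

lemma coalg_elem_id:
  assumes x: "x \<in> coalgebras V C P" and D: "D \<in> Obj V"
  shows "coalg_elem x x D (EId C (fst x) \<bullet> bang V D)"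
  unfolding coalg_elem_def
proof (intro conjI ballI allI impI)
  note X = coalgebra_obj[OF x]
  show "EId C (fst x) \<bullet> bang V D \<in> Hom V D (EHom C (fst x) (fst x))"
    by (rule gid_hom[OF X D])
  fix r K h p
  assume r: "r \<in> R" and h: "h \<in> Hom V K D" and p: "p \<in> Hom V K (OpObj P r)"
  have K: "K \<in> Obj V"
    using Hom_obj[OF h] by blast
  note \<phi>p = comp_hom[OF p coalgebra_structure_hom[OF x r]]
  have "(EId C (fst x) \<bullet> bang V D) \<bullet> h = EId C (fst x) \<bullet> bang V K"
    using comp_assoc[OF h bang_hom[OF D] eid_hom[OF X]] bang_comp[OF h] by simp
  then show "gcomp (fst x) (tpow C (fst x) r) (tpow C (fst x) r)
        (gpow (fst x) (fst x) r ((EId C (fst x) \<bullet> bang V D) \<bullet> h)) (snd x r \<bullet> p) =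
      gcomp (fst x) (fst x) (tpow C (fst x) r) (snd x r \<bullet> p) ((EId C (fst x) \<bullet> bang V D) \<bullet> h)"
    using gcomp_left[OF X tpow_obj[OF X] \<phi>p] gcomp_right[OF X tpow_obj[OF X] \<phi>p]
    by (simp add: gpow_id[OF X K])
qed

lemma coalg_elem_gcomp:
  assumes x: "x \<in> coalgebras V C P" and y: "y \<in> coalgebras V C P" and z: "z \<in> coalgebras V C P"
    and u: "coalg_elem y z D u" and v: "coalg_elem x y D v"
  shows "coalg_elem x z D (gcomp (fst x) (fst y) (fst z) u v)"
  unfolding coalg_elem_def
proof (intro conjI ballI allI impI)
  note X = coalgebra_obj[OF x] and Y = coalgebra_obj[OF y] and Z = coalgebra_obj[OF z]
  show "gcomp (fst x) (fst y) (fst z) u v \<in> Hom V D (EHom C (fst x) (fst z))"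
    by (rule gcomp_hom[OF X Y Z coalg_elem_hom[OF u] coalg_elem_hom[OF v]])
  fix r K h p
  assume r: "r \<in> R" and h: "h \<in> Hom V K D" and p: "p \<in> Hom V K (OpObj P r)"
  note Xr = tpow_obj[OF X, of r] and Yr = tpow_obj[OF Y, of r] and Zr = tpow_obj[OF Z, of r]
  note \<phi>x = comp_hom[OF p coalgebra_structure_hom[OF x r]]
    and \<phi>y = comp_hom[OF p coalgebra_structure_hom[OF y r]]
    and \<phi>z = comp_hom[OF p coalgebra_structure_hom[OF z r]]
  note uh = coalg_elem_comp[OF u h] and vh = coalg_elem_comp[OF v h]
  note uh' = coalg_elem_hom[OF uh] and vh' = coalg_elem_hom[OF vh]
  note pu = gpow_hom[OF Y Z uh', of r] and pv = gpow_hom[OF X Y vh', of r]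
  show "gcomp (fst x) (tpow C (fst x) r) (tpow C (fst z) r)
        (gpow (fst x) (fst z) r (gcomp (fst x) (fst y) (fst z) u v \<bullet> h)) (snd x r \<bullet> p) =
      gcomp (fst x) (fst z) (tpow C (fst z) r) (snd z r \<bullet> p) (gcomp (fst x) (fst y) (fst z) u v \<bullet> h)"
    \<comment> \<open>Restriction to \<open>K\<close> and \<open>gpow_gcomp\<close> split the tensor
      power. Then the condition on \<open>v\<close> moves it past the structure of \<open>x\<close>,
      reassociation exposes the condition on \<open>u\<close>, and a last reassociation restores the
      composite. The instances of \<open>gcomp_assoc\<close> are fixed because the middle one is
      used from right to left.\<close>
    by (simp add: gcomp_comp[OF X Y Z coalg_elem_hom[OF u] coalg_elem_hom[OF v] h]
        gpow_gcomp[OF X Y Z uh' vh'] gcomp_assoc[OF X Xr Yr Zr pu pv \<phi>x]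
        coalg_elem_eq[OF vh r p] gcomp_assoc[OF X Y Yr Zr pu \<phi>y vh', symmetric]
        coalg_elem_eq[OF uh r p] gcomp_assoc[OF X Y Z Zr \<phi>z uh' vh'])
qed

section \<open>The two equaliser maps and the universal property of mapping objects\<close>

lemma coalg_f_eq:
  "coalg_f V C P x y r =
     EComp C (fst x) (tpow C (fst x) r) (tpow C (fst y) r)
       \<bullet> pmap V (tens_hom V C (replicate r (fst x, fst y))) (Id V (EHom C (fst x) (tpow C (fst x) r)))
       \<bullet> pmap V (diag V r (EHom C (fst x) (fst y))) (Id V (EHom C (fst x) (tpow C (fst x) r)))
       \<bullet> pmap V (Id V (EHom C (fst x) (fst y))) (snd x r)"
  by (simp add: coalg_f_def split: prod.split)

lemma coalg_g_eq:
  "coalg_g V C P x y r = EComp C (fst x) (fst y) (tpow C (fst y) r)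
     \<bullet> swap V (EHom C (fst x) (fst y)) (EHom C (fst y) (tpow C (fst y) r))
     \<bullet> pmap V (Id V (EHom C (fst x) (fst y))) (snd y r)"
  by (simp add: coalg_g_def split: prod.split)

context
  fixes x y :: "'c \<times> (nat \<Rightarrow> 'a)" and r :: nat
  assumes x: "x \<in> coalgebras V C P" and y: "y \<in> coalgebras V C P" and r: "r \<in> R"
begin

text \<open>Evaluated factor by factor at the element \<open>pair V v p\<close>, the adjoint of the
  first map yields the left side of the condition in \<open>coalg_elem\<close>.\<close>

lemma coalg_f_hom:
  "coalg_f V C P x y r \<in>
    Hom V (Prod V (EHom C (fst x) (fst y)) (OpObj P r)) (EHom C (fst x) (tpow C (fst y) r))"
  and coalg_f_pair:
  "\<lbrakk>v \<in> Hom V D (EHom C (fst x) (fst y)); p \<in> Hom V D (OpObj P r)\<rbrakk> \<Longrightarrow>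
    coalg_f V C P x y r \<bullet> pair V v p =
    gcomp (fst x) (tpow C (fst x) r) (tpow C (fst y) r) (gpow (fst x) (fst y) r v) (snd x r \<bullet> p)"
proof -
  note X = coalgebra_obj[OF x] and Y = coalgebra_obj[OF y]
  note Xr = tpow_obj[OF X, of r] and Yr = tpow_obj[OF Y, of r]
  note \<phi> = coalgebra_structure_hom[OF x r]
  note i = id_hom[OF ehom_obj[OF X Xr]] and j = id_hom[OF ehom_obj[OF X Y]]
    and c = ecomp_hom[OF X Xr Yr] and t = tens_hom_replicate_hom[OF X Y, of r]
    and d = diag_hom[OF ehom_obj[OF X Y], of r]
  note m1 = pmap_hom[OF t i] and m2 = pmap_hom[OF d i] and m3 = pmap_hom[OF j \<phi>]
  show "coalg_f V C P x y r \<in>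
      Hom V (Prod V (EHom C (fst x) (fst y)) (OpObj P r)) (EHom C (fst x) (tpow C (fst y) r))"
    unfolding coalg_f_eq by (rule comp_hom[OF comp_hom[OF comp_hom[OF m3 m2] m1] c])
  assume v: "v \<in> Hom V D (EHom C (fst x) (fst y))" and p: "p \<in> Hom V D (OpObj P r)"
  note vp = pair_hom[OF v p] and \<phi>p = comp_hom[OF p \<phi>]
  show "coalg_f V C P x y r \<bullet> pair V v p =
    gcomp (fst x) (tpow C (fst x) r) (tpow C (fst y) r) (gpow (fst x) (fst y) r v) (snd x r \<bullet> p)"
    unfolding coalg_f_eq gcomp_def gpow_def
    by (simp add: comp_assoc[OF vp comp_hom[OF comp_hom[OF m3 m2] m1] c]
        comp_assoc[OF vp comp_hom[OF m3 m2] m1] comp_assoc[OF vp m3 m2]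
        pmap_pair[OF j \<phi> v p] id_left[OF v] pmap_pair[OF d i v \<phi>p] id_left[OF \<phi>p]
        pmap_pair[OF t i comp_hom[OF v d] \<phi>p])
qed

text \<open>The element \<open>v\<close> comes first in the pair but is composed first as an arrow,
  hence the swap before \<open>EComp\<close>; the value is the right side of the condition in
  \<open>coalg_elem\<close>.\<close>

lemma coalg_g_hom:
  "coalg_g V C P x y r \<in>
    Hom V (Prod V (EHom C (fst x) (fst y)) (OpObj P r)) (EHom C (fst x) (tpow C (fst y) r))"
  and coalg_g_pair:
  "\<lbrakk>v \<in> Hom V D (EHom C (fst x) (fst y)); p \<in> Hom V D (OpObj P r)\<rbrakk> \<Longrightarrow>
    coalg_g V C P x y r \<bullet> pair V v p = gcomp (fst x) (fst y) (tpow C (fst y) r) (snd y r \<bullet> p) v"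
proof -
  note X = coalgebra_obj[OF x] and Y = coalgebra_obj[OF y]
  note Yr = tpow_obj[OF Y, of r]
  note \<phi> = coalgebra_structure_hom[OF y r]
  note j = id_hom[OF ehom_obj[OF X Y]] and c = ecomp_hom[OF X Y Yr]
    and s = swap_hom[OF ehom_obj[OF X Y] ehom_obj[OF Y Yr]]
  note m = pmap_hom[OF j \<phi>]
  show "coalg_g V C P x y r \<in>
      Hom V (Prod V (EHom C (fst x) (fst y)) (OpObj P r)) (EHom C (fst x) (tpow C (fst y) r))"
    unfolding coalg_g_eq by (rule comp_hom[OF comp_hom[OF m s] c])
  assume v: "v \<in> Hom V D (EHom C (fst x) (fst y))" and p: "p \<in> Hom V D (OpObj P r)"
  note vp = pair_hom[OF v p] and \<phi>p = comp_hom[OF p \<phi>]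
  show "coalg_g V C P x y r \<bullet> pair V v p = gcomp (fst x) (fst y) (tpow C (fst y) r) (snd y r \<bullet> p) v"
    unfolding coalg_g_eq gcomp_def
    by (simp add: comp_assoc[OF vp comp_hom[OF m s] c] comp_assoc[OF vp m s]
        pmap_pair[OF j \<phi> v p] id_left[OF v] swap_pair[OF v \<phi>p])
qed

end

text \<open>Two reductions: \<open>curry_comp_eq_iff\<close> removes the internal hom, and
  \<open>prod_ext\<close> turns the resulting equation on the product of \<open>D\<close> and
  \<open>OpObj P r\<close> into one for all pairs \<open>(h, p)\<close>, which is the stagewise
  condition.\<close>

lemma coalg_elem_iff_curry:
  assumes x: "x \<in> coalgebras V C P" and y: "y \<in> coalgebras V C P"
    and v: "v \<in> Hom V D (EHom C (fst x) (fst y))"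
  defines "H \<equiv> EHom C (fst x) (fst y)" and "K \<equiv> \<lambda>r. EHom C (fst x) (tpow C (fst y) r)"
  shows "coalg_elem x y D v \<longleftrightarrow> (\<forall>r\<in>R.
    curry V H (OpObj P r) (K r) (coalg_f V C P x y r) \<bullet> v =
    curry V H (OpObj P r) (K r) (coalg_g V C P x y r) \<bullet> v)"
proof -
  have D: "D \<in> Obj V" and H: "H \<in> Obj V"
    using Hom_obj[OF v] by (auto simp: H_def)
  have *: "curry V H (OpObj P r) (K r) (coalg_f V C P x y r) \<bullet> v =
      curry V H (OpObj P r) (K r) (coalg_g V C P x y r) \<bullet> v \<longleftrightarrow>
    (\<forall>E h p. h \<in> Hom V E D \<longrightarrow> p \<in> Hom V E (OpObj P r) \<longrightarrow>
      coalg_f V C P x y r \<bullet> pair V (v \<bullet> h) p = coalg_g V C P x y r \<bullet> pair V (v \<bullet> h) p)"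
    (is "?c \<longleftrightarrow> ?e") if r: "r \<in> R" for r
  proof -
    note i = id_hom[OF op_obj[of r]]
    have f: "coalg_f V C P x y r \<in> Hom V (Prod V H (OpObj P r)) (K r)"
      and g: "coalg_g V C P x y r \<in> Hom V (Prod V H (OpObj P r)) (K r)"
      using coalg_f_hom[OF x y r] coalg_g_hom[OF x y r] by (simp_all add: H_def K_def)
    have v': "v \<in> Hom V D H"
      using v by (simp add: H_def)
    note vi = pmap_hom[OF v' i]
    have c: "?c \<longleftrightarrow> coalg_f V C P x y r \<bullet> pmap V v (Id V (OpObj P r)) =
        coalg_g V C P x y r \<bullet> pmap V v (Id V (OpObj P r))"
      by (rule curry_comp_eq_iff[OF f g op_obj v'])
    have "(k \<bullet> pmap V v (Id V (OpObj P r))) \<bullet> pair V h p = k \<bullet> pair V (v \<bullet> h) p"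
      if "k \<in> Hom V (Prod V H (OpObj P r)) (K r)" "h \<in> Hom V E D" "p \<in> Hom V E (OpObj P r)"
      for k E h p
      using comp_assoc[OF pair_hom[OF that(2,3)] vi that(1)] pmap_pair[OF v' i that(2,3)]
        id_left[OF that(3)] by simp
    note at = this[OF f] this[OF g]
    show ?thesis
      unfolding c
    proof
      assume "coalg_f V C P x y r \<bullet> pmap V v (Id V (OpObj P r)) =
        coalg_g V C P x y r \<bullet> pmap V v (Id V (OpObj P r))"
      then show ?e
        using at by metis
    next
      assume ?e
      then show "coalg_f V C P x y r \<bullet> pmap V v (Id V (OpObj P r)) =
        coalg_g V C P x y r \<bullet> pmap V v (Id V (OpObj P r))"
        by (intro prod_ext[OF comp_hom[OF vi f] comp_hom[OF vi g] D op_obj]) (simp add: at)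
    qed
  qed
  have "coalg_elem x y D v \<longleftrightarrow> (\<forall>r\<in>R. \<forall>E h p. h \<in> Hom V E D \<longrightarrow> p \<in> Hom V E (OpObj P r) \<longrightarrow>
      coalg_f V C P x y r \<bullet> pair V (v \<bullet> h) p = coalg_g V C P x y r \<bullet> pair V (v \<bullet> h) p)"
    using v coalg_f_pair[OF x y _ comp_hom[OF _ v]] coalg_g_pair[OF x y _ comp_hom[OF _ v]]
    unfolding coalg_elem_def by (simp cong: imp_cong)
  then show ?thesis
    using * by simp
qed

text \<open>The degrees in \<open>R\<close> are natural numbers, so the product of internal homs is
  countable; completeness supplies it and then the equaliser.\<close>

lemma mapping_object_exists:
  assumes "infinite (UNIV :: 'u set)" and "complete_category TYPE('u) V"
    and x: "x \<in> coalgebras V C P" and y: "y \<in> coalgebras V C P"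
  shows "\<exists>M e. is_mapping_object V C P x y M e"
proof -
  define H where "H = EHom C (fst x) (fst y)"
  define K where "K r = EHom C (fst x) (tpow C (fst y) r)" for r
  note X = coalgebra_obj[OF x] and Y = coalgebra_obj[OF y]
  have H: "H \<in> Obj V" and K: "K r \<in> Obj V" for r
    unfolding H_def K_def by (auto intro: ehom_obj tpow_obj X Y)
  obtain L p where L: "is_product V R (\<lambda>r. IHom V (OpObj P r) (K r)) L p"
    using complete_imp_countable_product[OF assms(1,2), of R "\<lambda>r. IHom V (OpObj P r) (K r)"]
      ihom_obj[OF op_obj K] by blast
  let ?f = "\<lambda>r. curry V H (OpObj P r) (K r) (coalg_f V C P x y r)"
  let ?g = "\<lambda>r. curry V H (OpObj P r) (K r) (coalg_g V C P x y r)"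
  have fg: "?f r \<in> Hom V H (IHom V (OpObj P r) (K r))" "?g r \<in> Hom V H (IHom V (OpObj P r) (K r))"
    if r: "r \<in> R" for r
    using curry_props[OF coalg_f_hom[OF x y r]] curry_props[OF coalg_g_hom[OF x y r]] H op_obj
    unfolding H_def K_def by blast+
  obtain f where f: "f \<in> Hom V H L" "\<forall>r\<in>R. p r \<bullet> f = ?f r"
    using ex1_implies_ex[OF is_product_lift[OF L H, of ?f, OF fg(1)]] by blast
  obtain g where g: "g \<in> Hom V H L" "\<forall>r\<in>R. p r \<bullet> g = ?g r"
    using ex1_implies_ex[OF is_product_lift[OF L H, of ?g, OF fg(2)]] by blast
  obtain M e where "is_equaliser V f g M e"
    using complete_imp_equaliser[OF assms(1,2) f(1) g(1)] by blast
  with L f g show ?thesis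
    unfolding is_mapping_object_def Let_def H_def K_def by blast
qed

text \<open>The inclusion is the universal element satisfying \<open>coalg_elem\<close>. Everything
  below uses mapping objects only through this property, in which the chosen product and the maps
  into it no longer appear.\<close>

lemma mapping_object_universal:
  assumes x: "x \<in> coalgebras V C P" and y: "y \<in> coalgebras V C P"
    and "is_mapping_object V C P x y M e"
  shows "coalg_elem x y M e"
    and "coalg_elem x y D v \<Longrightarrow> \<exists>!h. h \<in> Hom V D M \<and> e \<bullet> h = v"
proof -
  define H where "H = EHom C (fst x) (fst y)"
  define K where "K r = EHom C (fst x) (tpow C (fst y) r)" for r
  let ?f = "\<lambda>r. curry V H (OpObj P r) (K r) (coalg_f V C P x y r)"
  let ?g = "\<lambda>r. curry V H (OpObj P r) (K r) (coalg_g V C P x y r)"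
  obtain L p f g where L: "is_product V R (\<lambda>r. IHom V (OpObj P r) (K r)) L p"
    and f: "f \<in> Hom V H L" "\<forall>r\<in>R. p r \<bullet> f = ?f r"
    and g: "g \<in> Hom V H L" "\<forall>r\<in>R. p r \<bullet> g = ?g r"
    and E: "is_equaliser V f g M e"
    using assms(3) unfolding is_mapping_object_def Let_def H_def[symmetric] K_def[symmetric] by blast
  \<comment> \<open>The projections of the product are jointly monic, so equality after
    \<open>f\<close> and \<open>g\<close> may be tested degree by degree.\<close>
  have iff: "coalg_elem x y D v \<longleftrightarrow> f \<bullet> v = g \<bullet> v" if v: "v \<in> Hom V D H" for D v
  proof -
    note fv = comp_hom[OF v f(1)] and gv = comp_hom[OF v g(1)]
    have D: "D \<in> Obj V"
      using Hom_obj[OF v] by blast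
    have p: "p r \<in> Hom V L (IHom V (OpObj P r) (K r))" if "r \<in> R" for r
      using L that unfolding is_product_def by blast
    have pf: "p r \<bullet> f \<bullet> v = ?f r \<bullet> v" and pg: "p r \<bullet> g \<bullet> v = ?g r \<bullet> v" if "r \<in> R" for r
      using comp_assoc[OF v f(1) p[OF that]] comp_assoc[OF v g(1) p[OF that]] f(2) g(2) that by auto
    have "f \<bullet> v = g \<bullet> v" if eq: "\<forall>r\<in>R. ?f r \<bullet> v = ?g r \<bullet> v"
    proof -
      have "\<exists>!h. h \<in> Hom V D L \<and> (\<forall>r\<in>R. p r \<bullet> h = p r \<bullet> f \<bullet> v)"
        using is_product_lift[OF L D comp_hom[OF fv p]] .
      moreover have "\<forall>r\<in>R. p r \<bullet> g \<bullet> v = p r \<bullet> f \<bullet> v"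
        using eq pf pg by simp
      ultimately show ?thesis
        using fv gv by blast
    qed
    then have "f \<bullet> v = g \<bullet> v \<longleftrightarrow> (\<forall>r\<in>R. ?f r \<bullet> v = ?g r \<bullet> v)"
      by (auto simp: pf[symmetric] pg[symmetric])
    then show ?thesis
      using coalg_elem_iff_curry[OF x y v[unfolded H_def]] by (simp add: H_def K_def)
  qed
  have e: "e \<in> Hom V M H" "f \<bullet> e = g \<bullet> e"
    using E Hom_Dom[OF f(1)] unfolding is_equaliser_def by auto
  then show "coalg_elem x y M e"
    using iff by blast
  assume v: "coalg_elem x y D v"
  then have "v \<in> Hom V D H"
    using coalg_elem_hom by (simp add: H_def)
  with v iff E Hom_Dom[OF f(1)] show "\<exists>!h. h \<in> Hom V D M \<and> e \<bullet> h = v"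
    unfolding is_equaliser_def by simp
qed

end

section \<open>Composition and identities for a fixed choice of mapping objects\<close>

locale coalgebra_mapping_objects = operad_coalgebras V C P
  for V :: "('o, 'a) ccc" (structure) and C :: "('c, 'o, 'a) smvcat" and P :: "('o, 'a) operad_data" +
  fixes M :: "'c \<times> (nat \<Rightarrow> 'a) \<Rightarrow> 'c \<times> (nat \<Rightarrow> 'a) \<Rightarrow> 'o"
    and e :: "'c \<times> (nat \<Rightarrow> 'a) \<Rightarrow> 'c \<times> (nat \<Rightarrow> 'a) \<Rightarrow> 'a"
  assumes mapping_object:
    "\<lbrakk>x \<in> coalgebras V C P; y \<in> coalgebras V C P\<rbrakk> \<Longrightarrow> is_mapping_object V C P x y (M x y) (e x y)"
begin

abbreviation coalgs :: "('c \<times> (nat \<Rightarrow> 'a)) set" where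
  "coalgs \<equiv> coalgebras V C P"

abbreviation "CV \<equiv> coalg_vcat V C P M e"

lemma CV_simps: "EObj CV = coalgs" "EHom CV = M"
  by (simp_all add: coalg_vcat_def)

lemma incl_coalg_elem: "\<lbrakk>x \<in> coalgs; y \<in> coalgs\<rbrakk> \<Longrightarrow> coalg_elem x y (M x y) (e x y)"
  by (rule mapping_object_universal(1)[OF _ _ mapping_object])

lemma incl_hom: "\<lbrakk>x \<in> coalgs; y \<in> coalgs\<rbrakk> \<Longrightarrow> e x y \<in> Hom V (M x y) (EHom C (fst x) (fst y))"
  by (rule coalg_elem_hom[OF incl_coalg_elem])

lemma incl_obj: "\<lbrakk>x \<in> coalgs; y \<in> coalgs\<rbrakk> \<Longrightarrow> M x y \<in> Obj V"
  using Hom_obj[OF incl_hom] by blast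

text \<open>The element \<open>e x y \<bullet> h\<close> satisfies \<open>coalg_elem\<close>, so its
  factorisation through \<open>e x y\<close> is unique; thus inclusions are monic.\<close>

lemma incl_mono:
  assumes "x \<in> coalgs" and "y \<in> coalgs" and h: "h \<in> Hom V D (M x y)" and "h' \<in> Hom V D (M x y)"
    and "e x y \<bullet> h = e x y \<bullet> h'"
  shows "h = h'"
  using mapping_object_universal(2)[OF assms(1,2) mapping_object[OF assms(1,2)]
      coalg_elem_comp[OF incl_coalg_elem[OF assms(1,2)] h]] assms
  by metis

text \<open>The definite description in \<open>coalg_vcat\<close> is justified by composing the two
  inclusions at the stage \<open>Prod V (M y z) (M x y)\<close>: \<open>coalg_elem_gcomp\<close>
  makes the composite factor uniquely.\<close>

lemma CV_comp:
  assumes x: "x \<in> coalgs" and y: "y \<in> coalgs" and z: "z \<in> coalgs"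
  shows "EComp CV x y z \<in> Hom V (Prod V (M y z) (M x y)) (M x z)"
    and "e x z \<bullet> EComp CV x y z = EComp C (fst x) (fst y) (fst z) \<bullet> pmap V (e y z) (e x y)"
proof -
  let ?p = "Pr1 V (M y z) (M x y)" and ?q = "Pr2 V (M y z) (M x y)"
  have p: "?p \<in> Hom V (Prod V (M y z) (M x y)) (M y z)"
    and q: "?q \<in> Hom V (Prod V (M y z) (M x y)) (M x y)"
    by (intro pr1_hom pr2_hom incl_obj x y z)+
  have "EComp C (fst x) (fst y) (fst z) \<bullet> pmap V (e y z) (e x y) =
      gcomp (fst x) (fst y) (fst z) (e y z \<bullet> ?p) (e x y \<bullet> ?q)"
    unfolding gcomp_def pmap_def Hom_Dom[OF incl_hom[OF x y]] Hom_Dom[OF incl_hom[OF y z]] ..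
  moreover have "coalg_elem x z (Prod V (M y z) (M x y))
      (gcomp (fst x) (fst y) (fst z) (e y z \<bullet> ?p) (e x y \<bullet> ?q))"
    by (rule coalg_elem_gcomp[OF x y z coalg_elem_comp[OF incl_coalg_elem[OF y z] p]
          coalg_elem_comp[OF incl_coalg_elem[OF x y] q]])
  ultimately have "\<exists>!m. m \<in> Hom V (Prod V (M y z) (M x y)) (M x z) \<and>
      e x z \<bullet> m = EComp C (fst x) (fst y) (fst z) \<bullet> pmap V (e y z) (e x y)"
    using mapping_object_universal(2)[OF x z mapping_object[OF x z]] by simp
  from theI'[OF this]
  show "EComp CV x y z \<in> Hom V (Prod V (M y z) (M x y)) (M x z)"
    and "e x z \<bullet> EComp CV x y z = EComp C (fst x) (fst y) (fst z) \<bullet> pmap V (e y z) (e x y)"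
    by (simp_all add: coalg_vcat_def)
qed

lemma CV_id:
  assumes x: "x \<in> coalgs"
  shows "EId CV x \<in> Hom V (One V) (M x x)" and "e x x \<bullet> EId CV x = EId C (fst x)"
proof -
  \<comment> \<open>This identifies \<open>EId C (fst x)\<close> with the identity element at the
    terminal stage, where \<open>coalg_elem_id\<close> applies.\<close>
  have "bang V (One V) = Id V (One V)"
    by (rule to_one_unique[OF bang_hom[OF one_obj] id_hom[OF one_obj]])
  then have "coalg_elem x x (One V) (EId C (fst x))"
    using coalg_elem_id[OF x one_obj] id_right[OF eid_hom[OF coalgebra_obj[OF x]]] by simp
  then have "\<exists>!i. i \<in> Hom V (One V) (M x x) \<and> e x x \<bullet> i = EId C (fst x)"
    by (rule mapping_object_universal(2)[OF x x mapping_object[OF x x]])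
  from theI'[OF this]
  show "EId CV x \<in> Hom V (One V) (M x x)" and "e x x \<bullet> EId CV x = EId C (fst x)"
    by (simp_all add: coalg_vcat_def)
qed

text \<open>Inclusions carry composition of elements to \<open>\<star>\<close> in \<open>C\<close>.
  With \<open>incl_mono\<close>, associativity and the unit laws are thereby pulled back from
  \<open>C\<close>.\<close>

lemma incl_CV_comp:
  assumes x: "x \<in> coalgs" and y: "y \<in> coalgs" and z: "z \<in> coalgs"
    and a: "a \<in> Hom V D (M y z)" and b: "b \<in> Hom V D (M x y)"
  shows "e x z \<bullet> EComp CV x y z \<bullet> pair V a b =
    gcomp (fst x) (fst y) (fst z) (e y z \<bullet> a) (e x y \<bullet> b)"
proof -
  note ab = pair_hom[OF a b] and i = incl_hom[OF y z] incl_hom[OF x y]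
  note c = ecomp_hom[OF x[THEN coalgebra_obj] y[THEN coalgebra_obj] z[THEN coalgebra_obj]]
  show ?thesis
    unfolding gcomp_def
    using comp_assoc[OF ab CV_comp(1)[OF x y z] incl_hom[OF x z]]
    by (simp add: CV_comp(2)[OF x y z] comp_assoc[OF ab pmap_hom[OF i] c] pmap_pair[OF i a b])
qed

lemma CV_assoc:
  assumes w: "w \<in> coalgs" and x: "x \<in> coalgs" and y: "y \<in> coalgs" and z: "z \<in> coalgs"
  shows "EComp CV w x z \<bullet> pmap V (EComp CV x y z) (Id V (M w x)) =
    EComp CV w y z \<bullet> pmap V (Id V (M y z)) (EComp CV w x y) \<bullet> assoc V (M y z) (M x y) (M w x)"
    (is "?l = ?r")
proof -
  note obj = incl_obj[OF y z] incl_obj[OF x y] incl_obj[OF w x]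
  note c1 = CV_comp(1)[OF w x z] and c2 = CV_comp(1)[OF x y z]
    and c3 = CV_comp(1)[OF w y z] and c4 = CV_comp(1)[OF w x y]
  note i = id_hom[OF obj(3)] and j = id_hom[OF obj(1)]
  note l = pmap_hom[OF c2 i] and r = pmap_hom[OF j c4] and a = assoc_hom[OF obj]
  show ?thesis
  proof (rule prod_ext[OF comp_hom[OF l c1] comp_hom[OF comp_hom[OF a r] c3]
        prod_obj[OF obj(1,2)] obj(3)])
    fix K ts t
    assume ts: "ts \<in> Hom V K (Prod V (M y z) (M x y))" and v: "t \<in> Hom V K (M w x)"
    \<comment> \<open>\<open>prod_ext\<close> splits only the outer product, so the element of the
      inner one is decomposed by its projections.\<close>
    define s u where "s = Pr1 V (M y z) (M x y) \<bullet> ts" and "u = Pr2 V (M y z) (M x y) \<bullet> ts"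
    have s: "s \<in> Hom V K (M y z)" and u: "u \<in> Hom V K (M x y)"
      unfolding s_def u_def by (rule comp_hom[OF ts] pr1_hom pr2_hom obj)+
    have ts_eq: "ts = pair V s u"
      unfolding s_def u_def by (rule pair_eta[OF ts obj(1,2), symmetric])
    note su = pair_hom[OF s u] and uv = pair_hom[OF u v]
    note suv = pair_hom[OF su v]
    have eq: "?l \<bullet> pair V ts t = EComp CV w x z \<bullet> pair V (EComp CV x y z \<bullet> pair V s u) t"
      "?r \<bullet> pair V ts t = EComp CV w y z \<bullet> pair V s (EComp CV w x y \<bullet> pair V u t)"
      unfolding ts_eq
      by (simp_all add: comp_assoc[OF suv l c1] pmap_pair[OF c2 i su v] id_left[OF v]
          comp_assoc[OF suv comp_hom[OF a r] c3] comp_assoc[OF suv a r] assoc_pair[OF s u v]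
          pmap_pair[OF j c4 s uv] id_left[OF s])
    show "?l \<bullet> pair V ts t = ?r \<bullet> pair V ts t"
      unfolding eq
    proof (rule incl_mono[OF w z comp_hom[OF pair_hom[OF comp_hom[OF su c2] v] c1]
          comp_hom[OF pair_hom[OF s comp_hom[OF uv c4]] c3]])
      show "e w z \<bullet> EComp CV w x z \<bullet> pair V (EComp CV x y z \<bullet> pair V s u) t =
        e w z \<bullet> EComp CV w y z \<bullet> pair V s (EComp CV w x y \<bullet> pair V u t)"
        by (simp add: incl_CV_comp[OF w x z comp_hom[OF su c2] v] incl_CV_comp[OF x y z s u]
            incl_CV_comp[OF w y z s comp_hom[OF uv c4]] incl_CV_comp[OF w x y u v]
            gcomp_assoc[OF w[THEN coalgebra_obj] x[THEN coalgebra_obj] y[THEN coalgebra_obj]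
              z[THEN coalgebra_obj] comp_hom[OF s incl_hom[OF y z]] comp_hom[OF u incl_hom[OF x y]]
              comp_hom[OF v incl_hom[OF w x]]])
    qed
  qed
qed

lemma incl_CV_id:
  assumes x: "x \<in> coalgs" and a: "a \<in> Hom V D (One V)"
  shows "e x x \<bullet> EId CV x \<bullet> a = EId C (fst x) \<bullet> bang V D"
  using comp_assoc[OF a CV_id(1)[OF x] incl_hom[OF x x]] CV_id(2)[OF x]
    to_one_unique[OF a bang_hom] Hom_obj[OF a] by simp

lemma CV_id_right:
  assumes x: "x \<in> coalgs" and y: "y \<in> coalgs"
  shows "EComp CV x x y \<bullet> pmap V (Id V (M x y)) (EId CV x) = Pr1 V (M x y) (One V)"
proof -
  note obj = incl_obj[OF x y]
  note i = id_hom[OF obj] and j = CV_id(1)[OF x] and c = CV_comp(1)[OF x x y]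
  note r = pmap_hom[OF i j]
  show ?thesis
  proof (rule prod_ext[OF comp_hom[OF r c] pr1_hom[OF obj one_obj] obj one_obj])
    fix K a b
    assume a: "a \<in> Hom V K (M x y)" and b: "b \<in> Hom V K (One V)"
    note ea = comp_hom[OF a incl_hom[OF x y]] and jb = comp_hom[OF b j]
    have "EComp CV x x y \<bullet> pair V a (EId CV x \<bullet> b) = a"
      by (rule incl_mono[OF x y comp_hom[OF pair_hom[OF a jb] c] a])
        (simp add: incl_CV_comp[OF x x y a jb] incl_CV_id[OF x b]
          gcomp_right[OF x[THEN coalgebra_obj] y[THEN coalgebra_obj] ea])
    then show "(EComp CV x x y \<bullet> pmap V (Id V (M x y)) (EId CV x)) \<bullet> pair V a b =
        Pr1 V (M x y) (One V) \<bullet> pair V a b"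
      by (simp add: comp_assoc[OF pair_hom[OF a b] r c] pmap_pair[OF i j a b] id_left[OF a]
          pr1_pair[OF a b])
  qed
qed

lemma CV_id_left:
  assumes x: "x \<in> coalgs" and y: "y \<in> coalgs"
  shows "EComp CV x y y \<bullet> pmap V (EId CV y) (Id V (M x y)) = Pr2 V (One V) (M x y)"
proof -
  note obj = incl_obj[OF x y]
  note i = id_hom[OF obj] and j = CV_id(1)[OF y] and c = CV_comp(1)[OF x y y]
  note r = pmap_hom[OF j i]
  show ?thesis
  proof (rule prod_ext[OF comp_hom[OF r c] pr2_hom[OF one_obj obj] one_obj obj])
    fix K b a
    assume b: "b \<in> Hom V K (One V)" and a: "a \<in> Hom V K (M x y)"
    note ea = comp_hom[OF a incl_hom[OF x y]] and jb = comp_hom[OF b j]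
    have "EComp CV x y y \<bullet> pair V (EId CV y \<bullet> b) a = a"
      by (rule incl_mono[OF x y comp_hom[OF pair_hom[OF jb a] c] a])
        (simp add: incl_CV_comp[OF x y y jb a] incl_CV_id[OF y b]
          gcomp_left[OF x[THEN coalgebra_obj] y[THEN coalgebra_obj] ea])
    then show "(EComp CV x y y \<bullet> pmap V (EId CV y) (Id V (M x y))) \<bullet> pair V b a =
        Pr2 V (One V) (M x y) \<bullet> pair V b a"
      by (simp add: comp_assoc[OF pair_hom[OF b a] r c] pmap_pair[OF j i b a] id_left[OF a]
          pr2_pair[OF b a])
  qed
qed

lemma V_category_CV: "V_category V CV"
  by unfold_locales
    (simp_all add: CV_simps incl_obj CV_comp(1) CV_id(1) CV_assoc CV_id_right CV_id_left)

text \<open>The two functor equations are those that characterise \<open>EComp\<close> and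
  \<open>EId\<close> of \<open>CV\<close>.\<close>

lemma V_functor_incl: "V_functor V CV C fst e"
  unfolding V_functor_def by (simp add: CV_simps coalgebra_obj incl_hom CV_comp(2) CV_id(2))

end

text \<open>Mapping objects are determined only up to isomorphism, hence the quantification over all
  choices. Functoriality of the inclusions is the precise sense in which composition and identities
  are restricted from \<open>C\<close>.\<close>

theorem theorem1p1:
  fixes V :: "('o, 'a) ccc"
    and C :: "('c, 'o, 'a) smvcat"
    and P :: "('o, 'a) operad_data"
  assumes "cartesian_closed_category V"
    and "infinite (UNIV :: 'u set)"
    and "complete_category TYPE('u) V"
    and "cocomplete_category TYPE('u) V"
    and "symmetric_monoidal_V_category V C"
    and "operad V P"
  shows "(\<forall>x \<in> coalgebras V C P. \<forall>y \<in> coalgebras V C P. \<exists>M e. is_mapping_object V C P x y M e) \<and>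
    (\<forall>M e. (\<forall>x \<in> coalgebras V C P. \<forall>y \<in> coalgebras V C P.
               is_mapping_object V C P x y (M x y) (e x y)) \<longrightarrow>
       V_category V (coalg_vcat V C P M e) \<and>
       V_functor V (coalg_vcat V C P M e) C fst e)"
proof -
  interpret operad_coalgebras V C P
    by (intro operad_coalgebras.intro assms(5,6))
  show ?thesis
  proof (intro conjI ballI allI impI)
    fix x y
    assume "x \<in> coalgebras V C P" and "y \<in> coalgebras V C P"
    then show "\<exists>M e. is_mapping_object V C P x y M e"
      by (rule mapping_object_exists[OF assms(2,3)])
  next
    fix M e
    assume "\<forall>x \<in> coalgebras V C P. \<forall>y \<in> coalgebras V C P.
      is_mapping_object V C P x y (M x y) (e x y)"
    then interpret coalgebra_mapping_objects V C P M e
      by unfold_locales blast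
    show "V_category V (coalg_vcat V C P M e)" and "V_functor V (coalg_vcat V C P M e) C fst e"
      by (rule V_category_CV V_functor_incl)+
  qed
qed

end
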